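(* Let $0\le x_0<x_F<\infty$ and suppose $X_1,\dots,X_n$ are i.i.d. from $F_\theta$, where $F_\theta(x)=1-\left(\frac{x_F-x}{x_F-x_0}\right)^\theta$ for $x\in[x_0,x_F]$ and $\theta>0$. For any $\delta\in(0,1)$, let the exploration length satisfy $m=o(n)$ and $m=\omega(\log(1/\delta)\log^2n)$. Then the stopping policy $\tau$ of the algorithm CDP-OL with horizon $n$, exploration length $m$ and confidence parameter $\delta$ satisfies $$\mathrm{CR}_n(\tau;\theta)\ge(1-\delta)\left(1-O\!\left(n^{-1/\theta}\right)\right).$$
   Context: Stopping problem: the rewards $X_1,\dots,X_n$ are observed sequentially, with $\theta$ unknown to the policy ($x_0,x_F$ known). A policy is a stopping time $\tau$ adapted to $(X_t)$, with reward $X_\tau$. $\mathrm{OPT}(\theta):=\mathbb E_\theta[\max_{t\in[n]}X_t]$ and $\mathrm{CR}_n(\tau;\theta):=\mathbb E_\theta[X_\tau]/\mathrm{OPT}(\theta)$. Algorithm CDP-OL for these rewards (horizon $n$, exploration length $m<n$, confidence parameter $\delta$): reject $X_1,\dots,X_m$. Put $\phi(x)=\log\frac{x_F-x_0}{x_F-x}$, $\widehat\theta_m=m/\sum_{i=1}^m\phi(X_i)$, $\varepsilon_m=\sqrt{4\log(2/\delta)/m}$, $\theta^{(\mathrm U)}=(1+\varepsilon_m)\widehat\theta_m$, $N=n-m$. Compute $\widehat V_N=x_0+\frac{x_F-x_0}{\theta^{(\mathrm U)}+1}$ and $\widehat V_i=\widehat V_{i+1}+\frac{(x_F-\widehat V_{i+1})^{\theta^{(\mathrm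 U)}+1}}{(\theta^{(\mathrm U)}+1)(x_F-x_0)^{\theta^{(\mathrm U)}}}$ for $i=N-1,\dots,1$. Then $\tau=m+t$ for the smallest $t\in\{1,\dots,N-1\}$ with $X_{m+t}\ge\widehat V_{t+1}$, and $\tau=n$ if no such $t$ exists. Asymptotic notation is as $n\to\infty$. *)

theory Defs
  imports "HOL-Probability.Probability" "HOL-Library.Landau_Symbols"
begin

definition F_theta :: "real \<Rightarrow> real \<Rightarrow> real \<Rightarrow> real \<Rightarrow> real" where
  "F_theta x0 xF \<theta> x =
     (if x < x0 then 0
      else if x \<le> xF then 1 - ((xF - x) / (xF - x0)) powr \<theta>
      else 1)"

definition iid_sample :: "'a measure \<Rightarrow> nat \<Rightarrow> (nat \<Rightarrow> 'a \<Rightarrow> real) \<Rightarrow> (real \<Rightarrow> real) \<Rightarrow> bool" where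
  "iid_sample M n X F \<longleftrightarrow>
     prob_space M \<and>
     prob_space.indep_vars M (\<lambda>_. borel) X {1..n} \<and>
     (\<forall>t\<in>{1..n}. \<forall>x. cdf (distr M borel (X t)) x = F x)"

definition OPT :: "'a measure \<Rightarrow> nat \<Rightarrow> (nat \<Rightarrow> 'a \<Rightarrow> real) \<Rightarrow> real" where
  "OPT M n X = (\<integral>\<omega>. Max ((\<lambda>t. X t \<omega>) ` {1..n}) \<partial>M)"

definition CR :: "'a measure \<Rightarrow> nat \<Rightarrow> (nat \<Rightarrow> 'a \<Rightarrow> real) \<Rightarrow> ('a \<Rightarrow> nat) \<Rightarrow> real" where
  "CR M n X \<tau> = (\<integral>\<omega>. X (\<tau> \<omega>) \<omega> \<partial>M) / OPT M n X"

definition phi :: "real \<Rightarrow> real \<Rightarrow> real \<Rightarrow> real" where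
  "phi x0 xF x = ln ((xF - x0) / (xF - x))"

definition theta_hat :: "real \<Rightarrow> real \<Rightarrow> nat \<Rightarrow> (nat \<Rightarrow> real) \<Rightarrow> real" where
  "theta_hat x0 xF m x = real m / (\<Sum>i=1..m. phi x0 xF (x i))"

definition eps :: "nat \<Rightarrow> real \<Rightarrow> real" where
  "eps m \<delta> = sqrt (4 * ln (2 / \<delta>) / real m)"

definition theta_U :: "real \<Rightarrow> real \<Rightarrow> nat \<Rightarrow> real \<Rightarrow> (nat \<Rightarrow> real) \<Rightarrow> real" where
  "theta_U x0 xF m \<delta> x = (1 + eps m \<delta>) * theta_hat x0 xF m x"

text \<open>The backward recursion for the values is run forward in the number \<open>k = N - i\<close> of
  observations that remain after the \<open>i\<close>-th one.\<close>

primrec V_rem :: "real \<Rightarrow> real \<Rightarrow> real \<Rightarrow> nat \<Rightarrow> real" where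
  "V_rem x0 xF \<theta> 0 = x0 + (xF - x0) / (\<theta> + 1)"
| "V_rem x0 xF \<theta> (Suc k) =
     V_rem x0 xF \<theta> k
       + (xF - V_rem x0 xF \<theta> k) powr (\<theta> + 1) / ((\<theta> + 1) * (xF - x0) powr \<theta>)"

definition V_hat :: "real \<Rightarrow> real \<Rightarrow> real \<Rightarrow> nat \<Rightarrow> nat \<Rightarrow> real" where
  "V_hat x0 xF \<theta> N i = V_rem x0 xF \<theta> (N - i)"

lemma V_hat_last: "V_hat x0 xF \<theta> N N = x0 + (xF - x0) / (\<theta> + 1)"
  by (simp add: V_hat_def)

lemma V_hat_step:
  assumes "i < N"
  shows "V_hat x0 xF \<theta> N i = V_hat x0 xF \<theta> N (i + 1)
     + (xF - V_hat x0 xF \<theta> N (i + 1)) powr (\<theta> + 1) / ((\<theta> + 1) * (xF - x0) powr \<theta>)"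
proof -
  have "N - i = Suc (N - (i + 1))"
    using assms by simp
  then show ?thesis
    by (simp only: V_hat_def V_rem.simps)
qed

definition cdp_ol_accepts ::
  "real \<Rightarrow> real \<Rightarrow> nat \<Rightarrow> nat \<Rightarrow> real \<Rightarrow> (nat \<Rightarrow> real) \<Rightarrow> nat \<Rightarrow> bool" where
  "cdp_ol_accepts x0 xF n m \<delta> x t \<longleftrightarrow>
     t \<in> {1..n - m - 1} \<and> x (m + t) \<ge> V_hat x0 xF (theta_U x0 xF m \<delta> x) (n - m) (t + 1)"

text \<open>The policy as a function of the trajectory \<open>x 1, \<dots>, x n\<close> of observed rewards.\<close>

definition cdp_ol :: "real \<Rightarrow> real \<Rightarrow> nat \<Rightarrow> nat \<Rightarrow> real \<Rightarrow> (nat \<Rightarrow> real) \<Rightarrow> nat" where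
  "cdp_ol x0 xF n m \<delta> x =
     (if \<exists>t. cdp_ol_accepts x0 xF n m \<delta> x t
      then m + (LEAST t. cdp_ol_accepts x0 xF n m \<delta> x t)
      else n)"

text \<open>The policy is a stopping rule: whether it has stopped by time \<open>k\<close> and where
  depends only on the rewards up to time \<open>k\<close>.\<close>

lemma cdp_ol_accepts_cong:
  assumes "\<And>i. i \<in> {1..m + t} \<Longrightarrow> x i = y i"
  shows "cdp_ol_accepts x0 xF n m \<delta> x t = cdp_ol_accepts x0 xF n m \<delta> y t"
proof -
  have "(\<Sum>i=1..m. phi x0 xF (x i)) = (\<Sum>i=1..m. phi x0 xF (y i))"
    using assms by (intro sum.cong) auto
  then have "theta_U x0 xF m \<delta> x = theta_U x0 xF m \<delta> y"
    by (simp add: theta_U_def theta_hat_def)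
  then show ?thesis
    using assms[of "m + t"] by (auto simp: cdp_ol_accepts_def)
qed

lemma cdp_ol_non_anticipating:
  assumes "m < n" and k: "cdp_ol x0 xF n m \<delta> x = k"
    and eq: "\<And>i. i \<in> {1..k} \<Longrightarrow> x i = y i"
  shows "cdp_ol x0 xF n m \<delta> y = k"
proof (cases "\<exists>t. cdp_ol_accepts x0 xF n m \<delta> x t")
  case True
  define t where "t = (LEAST t. cdp_ol_accepts x0 xF n m \<delta> x t)"
  have kt: "k = m + t"
    using True k by (simp add: cdp_ol_def t_def)
  have acc: "cdp_ol_accepts x0 xF n m \<delta> x s = cdp_ol_accepts x0 xF n m \<delta> y s" if "s \<le> t" for s
    using that eq kt by (intro cdp_ol_accepts_cong) auto
  have t: "cdp_ol_accepts x0 xF n m \<delta> x t"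
    unfolding t_def using True by (rule LeastI_ex)
  have "(LEAST t. cdp_ol_accepts x0 xF n m \<delta> y t) = t"
  proof (rule Least_equality)
    show "cdp_ol_accepts x0 xF n m \<delta> y t"
      using t acc by simp
    show "t \<le> s" if "cdp_ol_accepts x0 xF n m \<delta> y s" for s
      using that acc[of s] unfolding t_def by (metis Least_le nle_le)
  qed
  then show ?thesis
    using t acc[of t] kt by (auto simp: cdp_ol_def)
next
  case False
  then have kn: "k = n"
    using k by (simp add: cdp_ol_def)
  have "\<not> cdp_ol_accepts x0 xF n m \<delta> y t" for t
  proof (cases "t \<in> {1..n - m - 1}")
    case True
    then have "cdp_ol_accepts x0 xF n m \<delta> x t = cdp_ol_accepts x0 xF n m \<delta> y t"
      using eq kn by (intro cdp_ol_accepts_cong) auto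
    then show ?thesis
      using False by blast
  qed (auto simp: cdp_ol_accepts_def)
  then show ?thesis
    using kn by (simp add: cdp_ol_def)
qed

end

theory Submission imports Defs begin

text \<open>
  The variables \<open>phi x0 xF (X i)\<close> are i.i.d. exponential with rate \<open>\<theta>\<close>, so Chernoff bounds give
  \<open>\<theta> \<le> theta_U \<le> \<theta> (1 + eps) / (1 - eps)\<close> with probability at least \<open>1 - \<delta>\<close>. The estimate depends only
  on the exploration phase, hence can be treated as a constant \<open>\<eta>\<close> afterwards. For \<open>\<eta> \<ge> \<theta>\<close> the
  thresholds \<open>V_rem x0 xF \<eta>\<close> underestimate the gain of one more observation from \<open>F_theta x0 xF \<theta>\<close>, so by
  induction the policy earns at least \<open>V_rem x0 xF \<eta> k\<close> from the last \<open>k + 1\<close> observations. The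
  recursion shows that \<open>xF - V_rem x0 xF \<eta> k\<close> is of order \<open>k powr (- 1 / \<eta>)\<close>, which is of order
  \<open>n powr (- 1 / \<theta>)\<close> because \<open>eps * ln n\<close> stays bounded.

  The growth condition on \<open>m\<close> controls \<open>eps\<close> only while \<open>\<delta>\<close> is bounded away from \<open>1\<close>. If \<open>\<delta>\<close> is close to
  \<open>1\<close>, it suffices that the competitive ratio is at least a positive constant, which already holds on the
  event \<open>theta_U \<le> 8 \<theta>\<close>.
\<close>

section \<open>Threshold values\<close>

text \<open>The quantity \<open>r k powr (- \<eta>)\<close> grows by at least
  \<open>\<eta> / (\<eta> + 1)\<close> per step: \<open>r (Suc k) = r k * (1 - y)\<close> with
  \<open>y = r k powr \<eta> / (\<eta> + 1)\<close>, and Bernoulli's inequality bounds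
  \<open>(1 - y) powr (- \<eta>)\<close> below by \<open>1 + \<eta> * y\<close>.\<close>

lemma power_law_recursion_bounds:
  fixes r :: "nat \<Rightarrow> real" and \<eta> :: real
  assumes \<eta>: "0 < \<eta>" and r0: "r 0 = \<eta> / (\<eta> + 1)"
    and r_Suc: "\<And>k. 0 < r k \<Longrightarrow> r (Suc k) = r k - r k powr (\<eta> + 1) / (\<eta> + 1)"
  shows "0 < r k \<and> r k \<le> 1 \<and> real (k + 1) * (\<eta> / (\<eta> + 1)) \<le> r k powr (- \<eta>)"
proof (induction k)
  case 0
  have b: "0 < r 0" "r 0 \<le> 1"
    using \<eta> by (auto simp: r0)
  \<comment> \<open>So \<open>r 0 powr (- \<eta>)\<close> is at least \<open>1\<close>, which
    dominates \<open>r 0 = \<eta> / (\<eta> + 1)\<close>.\<close>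
  have "1 powr (- \<eta>) \<le> r 0 powr (- \<eta>)"
    using b \<eta> by (intro powr_mono2') auto
  then show ?case
    using b r0 by simp
next
  case (Suc k)
  define y where "y = r k powr \<eta> / (\<eta> + 1)"
  have r: "0 < r k" "r k \<le> 1" using Suc.IH by auto
  have rS: "r (Suc k) = r k * (1 - y)"
    using r_Suc[OF r(1)] r(1) by (simp add: y_def powr_add right_diff_distrib)
  have "r k powr \<eta> \<le> 1"
    using r \<eta> by (intro powr_le1) auto
  then have y: "0 < y" "y < 1"
    using r \<eta> by (auto simp: y_def)
  \<comment> \<open>Bernoulli's inequality for the exponent \<open>- \<eta>\<close>, from
    \<open>ln (1 - y) \<le> - y\<close> and \<open>1 + t \<le> exp t\<close>.\<close>
  have "1 + \<eta> * y \<le> 1 + - \<eta> * ln (1 - y)"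
    using ln_le_minus_one[of "1 - y"] y \<eta> mult_left_mono[of "ln (1 - y)" "- y" \<eta>] by simp
  also have "\<dots> \<le> (1 - y) powr (- \<eta>)"
    using y exp_ge_add_one_self[of "- \<eta> * ln (1 - y)"] by (simp add: powr_def)
  finally have ber: "1 + \<eta> * y \<le> (1 - y) powr (- \<eta>)" .
  have "real (Suc k + 1) * (\<eta> / (\<eta> + 1)) = real (k + 1) * (\<eta> / (\<eta> + 1)) + \<eta> / (\<eta> + 1)"
    by (simp only: Suc_eq_plus1 of_nat_add of_nat_1 distrib_right mult_1_left)
  also have "\<dots> \<le> r k powr (- \<eta>) + \<eta> / (\<eta> + 1)"
    using Suc.IH by (intro add_right_mono) auto
  also have "\<dots> = r k powr (- \<eta>) * (1 + \<eta> * y)"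
  proof -
    have "r k powr (- \<eta>) * r k powr \<eta> = 1"
      using r by (simp flip: powr_add)
    then have "r k powr (- \<eta>) * (\<eta> * y) = \<eta> / (\<eta> + 1)"
      by (simp add: y_def mult.left_commute)
    then show ?thesis by (simp add: distrib_left)
  qed
  also have "\<dots> \<le> r k powr (- \<eta>) * (1 - y) powr (- \<eta>)"
    using ber by (intro mult_left_mono) auto
  also have "\<dots> = r (Suc k) powr (- \<eta>)"
    using r y by (simp add: rS powr_mult)
  finally have "real (Suc k + 1) * (\<eta> / (\<eta> + 1)) \<le> r (Suc k) powr (- \<eta>)" .
  moreover have "0 < r (Suc k)" "r (Suc k) \<le> 1"
    using r y by (auto simp: rS mult_le_one)
  ultimately show ?case by blast
qed

text \<open>Dividing the gap to \<open>xF\<close> by \<open>xF - x0\<close> removes the endpoints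
  from the recursion: the normalized gap \<open>r\<close> satisfies
  \<open>r (Suc k) = r k - r k powr (\<eta> + 1) / (\<eta> + 1)\<close>.\<close>

lemma V_gap_bounds:
  fixes x0 xF \<eta> :: real
  assumes x: "x0 < xF" and \<eta>: "0 < \<eta>"
  shows "0 < (xF - V_rem x0 xF \<eta> k) / (xF - x0)" "(xF - V_rem x0 xF \<eta> k) / (xF - x0) \<le> 1"
    "real (k + 1) * (\<eta> / (\<eta> + 1)) \<le> ((xF - V_rem x0 xF \<eta> k) / (xF - x0)) powr (- \<eta>)"
proof -
  define r where "r = (\<lambda>k. (xF - V_rem x0 xF \<eta> k) / (xF - x0))"
  have "0 < r k \<and> r k \<le> 1 \<and> real (k + 1) * (\<eta> / (\<eta> + 1)) \<le> r k powr (- \<eta>)"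
  proof (rule power_law_recursion_bounds[OF \<eta>])
    have "(xF - x0 - (xF - x0) / (\<eta> + 1)) / (xF - x0) = 1 - 1 / (\<eta> + 1)"
      using x by (simp add: diff_divide_distrib[of "xF - x0"])
    also have "\<dots> = \<eta> / (\<eta> + 1)"
      using \<eta> by (simp add: field_simps)
    finally show "r 0 = \<eta> / (\<eta> + 1)"
      by (simp add: r_def diff_diff_eq)
  next
    fix k assume "0 < r k"
    then have V: "V_rem x0 xF \<eta> k < xF"
      using x by (simp add: r_def zero_less_divide_iff)
    let ?q = "(xF - V_rem x0 xF \<eta> k) powr (\<eta> + 1) / ((\<eta> + 1) * (xF - x0) powr \<eta>)"
    have "r k powr (\<eta> + 1) / (\<eta> + 1) = ?q / (xF - x0)"
      using x V by (simp add: r_def powr_divide powr_add mult.commute)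
    moreover have "r (Suc k) = r k - ?q / (xF - x0)"
      by (simp only: r_def V_rem.simps diff_divide_distrib[symmetric] diff_diff_eq)
    ultimately show "r (Suc k) = r k - r k powr (\<eta> + 1) / (\<eta> + 1)"
      by simp
  qed
  then show "0 < (xF - V_rem x0 xF \<eta> k) / (xF - x0)" "(xF - V_rem x0 xF \<eta> k) / (xF - x0) \<le> 1"
    "real (k + 1) * (\<eta> / (\<eta> + 1)) \<le> ((xF - V_rem x0 xF \<eta> k) / (xF - x0)) powr (- \<eta>)"
    by (auto simp: r_def)
qed

lemma V_rem_bounds:
  assumes "x0 < xF" "0 < \<eta>"
  shows "x0 \<le> V_rem x0 xF \<eta> k" "V_rem x0 xF \<eta> k < xF"
proof -
  have "0 < xF - x0" using assms by simp
  with V_gap_bounds(1,2)[OF assms, of k] have "0 < xF - V_rem x0 xF \<eta> k" "xF - V_rem x0 xF \<eta> k \<le> xF - x0"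
    by (simp_all only: zero_less_divide_iff divide_le_eq_1_pos) auto
  then show "x0 \<le> V_rem x0 xF \<eta> k" "V_rem x0 xF \<eta> k < xF" by simp_all
qed

text \<open>The increments of the recursion are nonnegative. This serves the crude bound, where all
  thresholds are compared with the value of the last observation alone.\<close>

lemma V_rem_ge_0:
  assumes "0 < \<eta>"
  shows "V_rem x0 xF \<eta> 0 \<le> V_rem x0 xF \<eta> k"
proof (induction k)
  case (Suc k)
  have "V_rem x0 xF \<eta> k \<le> V_rem x0 xF \<eta> (Suc k)"
    using assms by simp
  with Suc.IH show ?case by (rule order_trans)
qed simp

text \<open>Raising the bound on the normalized gap to the power \<open>- (1 / \<eta>)\<close>
  reverses it and shows that the gap is at most of order
  \<open>k powr (- 1 / \<eta>)\<close>.\<close>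

lemma V_rem_lower_bound:
  assumes "x0 < xF" "0 < \<eta>"
  shows "xF - (xF - x0) * ((\<eta> + 1) / (\<eta> * real (k + 1))) powr (1 / \<eta>) \<le> V_rem x0 xF \<eta> k"
proof -
  define r where "r = (xF - V_rem x0 xF \<eta> k) / (xF - x0)"
  have r: "0 < r" "real (k + 1) * (\<eta> / (\<eta> + 1)) \<le> r powr (- \<eta>)"
    using V_gap_bounds[OF assms, of k] by (auto simp: r_def)
  have "r = (r powr (- \<eta>)) powr (- (1 / \<eta>))"
    using r assms by (simp add: powr_powr)
  also have "\<dots> \<le> (real (k + 1) * (\<eta> / (\<eta> + 1))) powr (- (1 / \<eta>))"
    using r assms by (intro powr_mono2') auto
  also have "\<dots> = (1 / (real (k + 1) * (\<eta> / (\<eta> + 1)))) powr (1 / \<eta>)"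
    using assms by (simp add: powr_minus powr_divide inverse_eq_divide)
  also have "1 / (real (k + 1) * (\<eta> / (\<eta> + 1))) = (\<eta> + 1) / (\<eta> * real (k + 1))"
    by (simp add: mult.commute)
  finally have "(xF - x0) * r \<le> (xF - x0) * ((\<eta> + 1) / (\<eta> * real (k + 1))) powr (1 / \<eta>)"
    using assms by (intro mult_left_mono) auto
  moreover have "(xF - x0) * r = xF - V_rem x0 xF \<eta> k"
    using assms by (simp add: r_def)
  ultimately show ?thesis by linarith
qed

text \<open>The normalized gap \<open>r\<close> lies in \<open>(0, 1]\<close>, so
  \<open>r powr (p + 1) / (p + 1)\<close> decreases in \<open>p\<close>. Hence an overestimate of
  \<theta> only understates the expected gain of one more observation.\<close>

lemma V_rem_Suc_le:
  assumes "x0 < xF" "0 < \<theta>" "\<theta> \<le> \<eta>"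
  shows "V_rem x0 xF \<eta> (Suc k)
    \<le> V_rem x0 xF \<eta> k + (xF - V_rem x0 xF \<eta> k) powr (\<theta> + 1) / ((\<theta> + 1) * (xF - x0) powr \<theta>)"
proof -
  define r where "r = (xF - V_rem x0 xF \<eta> k) / (xF - x0)"
  have r: "0 < r" "r \<le> 1"
    using V_gap_bounds[of x0 xF \<eta> k] assms by (auto simp: r_def)
  have eq: "(xF - V_rem x0 xF \<eta> k) powr (p + 1) / ((p + 1) * (xF - x0) powr p)
      = (xF - x0) * (r powr (p + 1) / (p + 1))" for p
    using assms V_rem_bounds(2)[of x0 xF \<eta> k] by (simp add: r_def powr_divide powr_add)
  have "r powr (\<eta> + 1) / (\<eta> + 1) \<le> r powr (\<theta> + 1) / (\<theta> + 1)"
    using r assms by (intro frac_le powr_mono') auto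
  then have "(xF - x0) * (r powr (\<eta> + 1) / (\<eta> + 1)) \<le> (xF - x0) * (r powr (\<theta> + 1) / (\<theta> + 1))"
    using assms(1) by (intro mult_left_mono) auto
  then show ?thesis
    by (simp only: V_rem.simps eq add_le_cancel_left)
qed

lemma measurable_V_rem [measurable]: "(\<lambda>\<eta>. V_rem x0 xF \<eta> k) \<in> borel_measurable borel"
  by (induction k) simp_all

section \<open>Threshold policies\<close>

text \<open>The reward of a threshold policy on the last \<open>k + 1\<close> of \<open>n\<close> observations; as for \<open>V_rem\<close>,
  thresholds are indexed by the number of observations that remain afterwards.\<close>

primrec threshold_reward :: "(nat \<Rightarrow> real) \<Rightarrow> nat \<Rightarrow> (nat \<Rightarrow> real) \<Rightarrow> nat \<Rightarrow> real" where
  "threshold_reward c n x 0 = x n"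
| "threshold_reward c n x (Suc k) =
     (if c k \<le> x (n - Suc k) then x (n - Suc k) else threshold_reward c n x k)"

lemma threshold_reward_cong:
  "(\<And>i. i \<in> {n - k..n} \<Longrightarrow> x i = y i) \<Longrightarrow> threshold_reward c n x k = threshold_reward c n y k"
proof (induction k)
  case (Suc k)
  have "x i = y i" if "i \<in> {n - k..n}" for i
    using that by (intro Suc.prems) auto
  with Suc.IH have "threshold_reward c n x k = threshold_reward c n y k" by blast
  moreover have "x (n - Suc k) = y (n - Suc k)"
    by (intro Suc.prems) auto
  ultimately show ?case by simp
qed simp

text \<open>Bounds on the observations thereby carry over to the reward, whatever the
  thresholds.\<close>

lemma threshold_reward_in_image: "threshold_reward c n x k \<in> x ` {n - k..n}"
proof (induction k)
  case (Suc k)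
  have "x ` {n - k..n} \<subseteq> x ` {n - Suc k..n}"
    by (intro image_mono) auto
  with Suc show ?case by auto
qed simp

text \<open>Needed for Fubini's theorem once the thresholds depend on the exploration phase, which
  is then the first component of \<open>p\<close>.\<close>

lemma measurable_threshold_reward:
  assumes "{n - k..n} \<subseteq> I" "\<And>j. j < k \<Longrightarrow> c j \<in> borel_measurable S"
  shows "(\<lambda>p. threshold_reward (\<lambda>j. c j (fst p)) n (snd p) k) \<in> borel_measurable (S \<Otimes>\<^sub>M Pi\<^sub>M I (\<lambda>_. borel))"
  using assms
proof (induction k)
  case 0
  then have "n \<in> I" by auto
  then show ?case by simp measurable
next
  case (Suc k)
  have [measurable]: "(\<lambda>p. threshold_reward (\<lambda>j. c j (fst p)) n (snd p) k) \<in> borel_measurable (S \<Otimes>\<^sub>M Pi\<^sub>M I (\<lambda>_. borel))"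
    proof (rule Suc.IH)
    have "{n - k..n} \<subseteq> {n - Suc k..n}" by auto
    with Suc.prems(1) show "{n - k..n} \<subseteq> I" by blast
  qed (use Suc.prems(2) in auto)
  have [measurable]: "c k \<in> borel_measurable S" and i: "n - Suc k \<in> I"
    using Suc.prems by auto
  have [measurable]: "(\<lambda>p. snd p (n - Suc k)) \<in> borel_measurable (S \<Otimes>\<^sub>M Pi\<^sub>M I (\<lambda>_. borel))"
    using i by measurable
  show ?case by simp measurable
qed

text \<open>Induction on \<open>k\<close>, under the invariant that nothing before relative time
  \<open>n - m - k\<close> is accepted. For \<open>k = n - m - 1\<close> the invariant concerns only
  \<open>t = 0\<close>, which is never accepted.\<close>

lemma cdp_ol_eq_threshold_reward:
  assumes "m < n"
  shows "x (cdp_ol x0 xF n m \<delta> x) = threshold_reward (V_rem x0 xF (theta_U x0 xF m \<delta> x)) n x (n - m - 1)"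
proof -
  let ?c = "V_rem x0 xF (theta_U x0 xF m \<delta> x)" and ?acc = "cdp_ol_accepts x0 xF n m \<delta> x"
  have "x (cdp_ol x0 xF n m \<delta> x) = threshold_reward ?c n x k"
    if "k < n - m" "\<And>t. t < n - m - k \<Longrightarrow> \<not> ?acc t" for k
    using that
  proof (induction k)
    case 0
    then have "\<not> ?acc t" for t
      by (cases "t < n - m") (auto simp: cdp_ol_accepts_def)
    then show ?case by (simp add: cdp_ol_def)
  next
    case (Suc k)
    let ?t = "n - m - Suc k"
    \<comment> \<open>The observation at relative time \<open>?t\<close> is compared with
      \<open>V_hat\<close> at \<open>?t + 1\<close>, which is \<open>V_rem\<close> at
      \<open>n - m - (?t + 1) = k\<close>.\<close>
    have mt: "m + ?t = n - Suc k" and k: "n - m - (?t + 1) = k" and t: "?t \<in> {1..n - m - 1}"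
      using Suc.prems(1) by auto
    have acc: "?acc ?t \<longleftrightarrow> ?c k \<le> x (n - Suc k)"
      using mt k t by (simp add: cdp_ol_accepts_def V_hat_def)
    show ?case
    proof (cases "?acc ?t")
      case True
      then have "(LEAST t. ?acc t) = ?t"
        using Suc.prems(2) by (intro Least_equality) (auto simp: not_less[symmetric])
      then have "cdp_ol x0 xF n m \<delta> x = n - Suc k"
        using True mt by (auto simp: cdp_ol_def)
      then show ?thesis using acc True by simp
    next
      case False
      have "\<not> ?acc t" if "t < n - m - k" for t
        using that False Suc.prems(2)[of t] by (cases "t = ?t") auto
      then show ?thesis
        using False acc Suc.IH Suc.prems(1) by simp
    qed
  qed
  moreover have "\<not> ?acc t" if "t < n - m - (n - m - 1)" for t
    using that assms by (auto simp: cdp_ol_accepts_def)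
  ultimately show ?thesis using assms by (meson diff_less zero_less_diff zero_less_one)
qed

text \<open>Fubini: \<open>Z\<close> may be frozen at a value \<open>z\<close>, and the inner
  expectation is at least \<open>L\<close> for \<open>z\<close> in \<open>A\<close> and nonnegative
  elsewhere. The null set in \<open>bounds\<close> is common to all \<open>z\<close> because the
  bound is also applied at the random value \<open>z = Z \<omega>\<close>.\<close>

lemma (in prob_space) indep_var_expectation_ge:
  fixes f :: "'b \<Rightarrow> 'b \<Rightarrow> real"
  assumes indep: "indep_var S Z T W"
    and f [measurable]: "(\<lambda>p. f (fst p) (snd p)) \<in> borel_measurable (S \<Otimes>\<^sub>M T)"
    and A [measurable]: "A \<in> sets S"
    and bounds: "AE \<omega> in M. \<forall>z. 0 \<le> f z (W \<omega>) \<and> f z (W \<omega>) \<le> C"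
    and L: "\<And>z. z \<in> A \<Longrightarrow> L \<le> expectation (\<lambda>\<omega>. f z (W \<omega>))" "0 \<le> L"
  shows "prob {\<omega> \<in> space M. Z \<omega> \<in> A} * L \<le> expectation (\<lambda>\<omega>. f (Z \<omega>) (W \<omega>))"
proof -
  have Z [measurable]: "Z \<in> measurable M S" and W [measurable]: "W \<in> measurable M T"
    using indep by (auto dest: indep_var_rv1 indep_var_rv2)
  have nn_int: "(\<integral>\<^sup>+\<omega>. ennreal (g \<omega>) \<partial>M) = ennreal (expectation g)"
    if "g \<in> borel_measurable M" "AE \<omega> in M. 0 \<le> g \<omega> \<and> g \<omega> \<le> C" for g
  proof (rule nn_integral_eq_integral)
    show "integrable M g"
      using that by (intro integrable_const_bound[where B = C]) (auto elim: eventually_mono)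
  qed (use that in \<open>auto elim: eventually_mono\<close>)
  interpret W: prob_space "distr M T W" by (rule prob_space_distr) simp
  have "ennreal (prob {\<omega> \<in> space M. Z \<omega> \<in> A} * L)
      = (\<integral>\<^sup>+\<omega>. ennreal L * indicator {\<omega> \<in> space M. Z \<omega> \<in> A} \<omega> \<partial>M)"
    using L(2) by (simp add: nn_integral_cmult_indicator emeasure_eq_measure ennreal_mult' mult.commute)
  also have "\<dots> \<le> (\<integral>\<^sup>+\<omega>. (\<integral>\<^sup>+\<omega>'. ennreal (f (Z \<omega>) (W \<omega>')) \<partial>M) \<partial>M)"
  proof (rule nn_integral_mono)
    fix \<omega> assume \<omega>: "\<omega> \<in> space M"
    then have z: "Z \<omega> \<in> space S" using measurable_space[OF Z] by simp
    have m: "(\<lambda>\<omega>'. f (Z \<omega>) (W \<omega>')) \<in> borel_measurable M"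
      using measurable_compose[OF measurable_Pair[OF measurable_const[OF z] W] f] by simp
    have "AE \<omega>' in M. 0 \<le> f (Z \<omega>) (W \<omega>') \<and> f (Z \<omega>) (W \<omega>') \<le> C"
      using bounds by eventually_elim auto
    then show "ennreal L * indicator {\<omega> \<in> space M. Z \<omega> \<in> A} \<omega>
        \<le> (\<integral>\<^sup>+\<omega>'. ennreal (f (Z \<omega>) (W \<omega>')) \<partial>M)"
      using L(1)[of "Z \<omega>"] \<omega> by (auto simp: nn_int[OF m] ennreal_leI split: split_indicator)
  qed
  also have "\<dots> = (\<integral>\<^sup>+z. (\<integral>\<^sup>+w. ennreal (f z w) \<partial>distr M T W) \<partial>distr M S Z)"
  proof -
    have [measurable]: "(\<lambda>w. ennreal (f z w)) \<in> borel_measurable T" if "z \<in> space S" for z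
      using measurable_compose[OF measurable_Pair[OF measurable_const[OF that] measurable_ident] f] by simp
    have [measurable]: "(\<lambda>z. \<integral>\<^sup>+w. ennreal (f z w) \<partial>distr M T W) \<in> borel_measurable S"
      by (rule W.borel_measurable_nn_integral) (simp add: split_beta')
    have "(\<integral>\<^sup>+z. (\<integral>\<^sup>+w. ennreal (f z w) \<partial>distr M T W) \<partial>distr M S Z)
        = (\<integral>\<^sup>+\<omega>. (\<integral>\<^sup>+w. ennreal (f (Z \<omega>) w) \<partial>distr M T W) \<partial>M)"
      by (simp add: nn_integral_distr)
    also have "\<dots> = (\<integral>\<^sup>+\<omega>. (\<integral>\<^sup>+\<omega>'. ennreal (f (Z \<omega>) (W \<omega>')) \<partial>M) \<partial>M)"
      using measurable_space[OF Z] by (intro nn_integral_cong nn_integral_distr) auto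
    finally show ?thesis ..
  qed
  also have "\<dots> = (\<integral>\<^sup>+p. ennreal (f (fst p) (snd p)) \<partial>(distr M S Z \<Otimes>\<^sub>M distr M T W))"
    by (subst W.nn_integral_fst[symmetric]) auto
  \<comment> \<open>Independence enters here: the product of the marginal laws is the joint
    law.\<close>
  also have "distr M S Z \<Otimes>\<^sub>M distr M T W = distr M (S \<Otimes>\<^sub>M T) (\<lambda>\<omega>. (Z \<omega>, W \<omega>))"
    using indep by (simp add: indep_var_distribution_eq)
  also have "(\<integral>\<^sup>+p. ennreal (f (fst p) (snd p)) \<partial>\<dots>) = (\<integral>\<^sup>+\<omega>. ennreal (f (Z \<omega>) (W \<omega>)) \<partial>M)"
    by (subst nn_integral_distr) auto
  also have "\<dots> = ennreal (expectation (\<lambda>\<omega>. f (Z \<omega>) (W \<omega>)))"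
  proof (rule nn_int)
    show "(\<lambda>\<omega>. f (Z \<omega>) (W \<omega>)) \<in> borel_measurable M"
      using measurable_compose[OF measurable_Pair[OF Z W] f] by simp
  qed (use bounds in eventually_elim, auto)
  finally have "ennreal (prob {\<omega> \<in> space M. Z \<omega> \<in> A} * L)
      \<le> ennreal (expectation (\<lambda>\<omega>. f (Z \<omega>) (W \<omega>)))" .
  moreover have "0 \<le> expectation (\<lambda>\<omega>. f (Z \<omega>) (W \<omega>))"
    by (rule integral_nonneg_AE) (use bounds in eventually_elim, auto)
  ultimately show ?thesis
    by (simp add: ennreal_le_iff)
qed

section \<open>Power-law samples\<close>

text \<open>The difference of the two sides vanishes at \<open>0\<close> and is monotone on
  \<open>[0, 1]\<close>. The constant \<open>1 / 4\<close> matches \<open>eps\<close>, since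
  \<open>m * (eps m \<delta>)^2 / 4 = ln (2 / \<delta>)\<close>.\<close>

lemma ln_one_plus_le:
  fixes x :: real
  assumes "0 \<le> x" "x \<le> 1"
  shows "ln (1 + x) - x \<le> - (x\<^sup>2 / 4)"
proof -
  define f where "f = (\<lambda>x::real. x - x\<^sup>2 / 4 - ln (1 + x))"
  have "f 0 \<le> f x"
  proof (rule DERIV_nonneg_imp_nondecreasing[OF assms(1)])
    fix y :: real assume y: "0 \<le> y" "y \<le> x"
    have "(f has_real_derivative (1 - y / 2 - 1 / (1 + y))) (at y)"
      unfolding f_def using y by (auto intro!: derivative_eq_intros)
    moreover have "1 - y / 2 - 1 / (1 + y) = y * (1 - y) / (2 * (1 + y))"
      using y by (simp add: field_simps)
    moreover have "y * (1 - y) / (2 * (1 + y)) \<ge> 0"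
      using y assms by auto
    ultimately show "\<exists>z. (f has_real_derivative z) (at y) \<and> 0 \<le> z"
      by auto
  qed
  then show ?thesis by (simp add: f_def)
qed

text \<open>Counterpart for the lower tail. The power series would give \<open>1 / 2\<close> in
  place of \<open>1 / 4\<close>; the weaker constant is the one shared by both tails.\<close>

lemma ln_one_minus_le:
  fixes x :: real
  assumes "0 \<le> x" "x < 1"
  shows "ln (1 - x) + x \<le> - (x\<^sup>2 / 4)"
proof -
  define f where "f = (\<lambda>x::real. - x - x\<^sup>2 / 4 - ln (1 - x))"
  have "f 0 \<le> f x"
  proof (rule DERIV_nonneg_imp_nondecreasing[OF assms(1)])
    fix y :: real assume y: "0 \<le> y" "y \<le> x"
    have "(f has_real_derivative (- 1 - y / 2 + 1 / (1 - y))) (at y)"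
      unfolding f_def using y assms by (auto intro!: derivative_eq_intros)
    moreover have "- 1 - y / 2 + 1 / (1 - y) = y * (1 + y) / (2 * (1 - y))"
      using y assms by (simp add: field_simps)
    moreover have "y * (1 + y) / (2 * (1 - y)) \<ge> 0"
      using y assms by auto
    ultimately show "\<exists>z. (f has_real_derivative z) (at y) \<and> 0 \<le> z"
      by auto
  qed
  then show ?thesis by (simp add: f_def)
qed

section \<open>Integrals against the exponential density\<close>

lemma tendsto_exp_neg_mult_at_top:
  fixes c :: real
  assumes "0 < c"
  shows "((\<lambda>x. exp (- x * c)) \<longlongrightarrow> 0) at_top"
proof -
  have "filterlim (\<lambda>x. x * c) at_top at_top"
    by (rule filterlim_at_top_mult_tendsto_pos[OF tendsto_const assms filterlim_ident])
  then have "filterlim (\<lambda>x. - x * c) at_bot at_top"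
    by (simp add: filterlim_uminus_at_bot)
  then show ?thesis
    by (rule filterlim_compose[OF exp_at_bot])
qed

text \<open>With \<open>x\<close> the value of \<open>phi x0 xF\<close> at an observation,
  \<open>exp (- x)\<close> is its normalized gap to \<open>xF\<close>, so this is the normalized
  expected gain over a threshold with gap \<open>v\<close>.\<close>

lemma nn_integral_exponential_excess:
  fixes \<theta> v :: real
  assumes "\<theta> > 0" "0 < v" "v \<le> 1"
  shows "(\<integral>\<^sup>+x. exponential_density \<theta> x * ennreal (max 0 (v - exp (- x))) \<partial>lborel)
    = ennreal (v powr (\<theta> + 1) / (\<theta> + 1))"
proof -
  \<comment> \<open>The integrand vanishes to the left of \<open>a\<close>, and
    \<open>v \<le> 1\<close> places \<open>a\<close> in the support of the density.\<close>
  define a where "a = - ln v"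
  have a: "a \<ge> 0" "exp (- a) = v"
    using assms by (auto simp: a_def)
  let ?f = "\<lambda>x. \<theta> * exp (- x * \<theta>) * (v - exp (- x))"
  \<comment> \<open>An antiderivative of \<open>?f\<close> that tends to \<open>0\<close> at
    infinity, so the integral is \<open>- ?F a\<close>.\<close>
  let ?F = "\<lambda>x. - v * exp (- x * \<theta>) + \<theta> / (\<theta> + 1) * exp (- x * (\<theta> + 1))"
  have eq: "exponential_density \<theta> x * ennreal (max 0 (v - exp (- x)))
      = ennreal (?f x) * indicator {a..} x" for x
  proof (cases "a \<le> x")
    case True
    then have "exp (- x) \<le> v" using a by (metis exp_le_cancel_iff neg_le_iff_le)
    then show ?thesis
      using True a assms by (auto simp: exponential_density_def simp flip: ennreal_mult')
  next
    case False
    then have "v \<le> exp (- x)" using a by (metis exp_le_cancel_iff neg_le_iff_le linear)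
    then show ?thesis using False by (simp add: max_def)
  qed
  have "(\<integral>\<^sup>+x. exponential_density \<theta> x * ennreal (max 0 (v - exp (- x))) \<partial>lborel)
      = (\<integral>\<^sup>+x. ennreal (?f x) * indicator {a..} x \<partial>lborel)"
    unfolding eq ..
  also have "\<dots> = ennreal (0 - ?F a)"
  proof (rule nn_integral_FTC_atLeast)
    fix x assume "a \<le> x"
    have "exp (- x * (\<theta> + 1)) = exp (- x * \<theta>) * exp (- x)"
      by (simp add: algebra_simps flip: exp_add)
    moreover have "\<theta> / (\<theta> + 1) * (E * (- (\<theta> + 1))) = - (\<theta> * E)" for E
    proof -
      have "\<theta> + 1 \<noteq> 0" using assms(1) by linarith
      then have "\<theta> / (\<theta> + 1) * (\<theta> + 1) = \<theta>"
        by (rule nonzero_eq_divide_eq[THEN iffD1, OF _ refl])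
      then show ?thesis by (metis mult.commute mult.left_commute mult_minus_right)
    qed
    ultimately have "- v * (exp (- x * \<theta>) * (- \<theta>))
        + \<theta> / (\<theta> + 1) * (exp (- x * (\<theta> + 1)) * (- (\<theta> + 1))) = ?f x"
      by (simp only:) (simp add: right_diff_distrib)
    moreover have "(?F has_real_derivative - v * (exp (- x * \<theta>) * (- \<theta>))
        + \<theta> / (\<theta> + 1) * (exp (- x * (\<theta> + 1)) * (- (\<theta> + 1)))) (at x)"
      using assms(1) by (auto intro!: derivative_eq_intros)
    ultimately show "(?F has_real_derivative ?f x) (at x)"
      by simp
    have "exp (- x) \<le> v" using a \<open>a \<le> x\<close> by (metis exp_le_cancel_iff neg_le_iff_le)
    then show "0 \<le> ?f x" using assms by auto
  next
    have "(?F \<longlongrightarrow> - v * 0 + \<theta> / (\<theta> + 1) * 0) at_top"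
      using assms by (intro tendsto_intros tendsto_exp_neg_mult_at_top) auto
    then show "(?F \<longlongrightarrow> 0) at_top" by simp
  qed simp
  also have "0 - ?F a = v powr (\<theta> + 1) / (\<theta> + 1)"
  proof -
    have "exp (- a * c) = v powr c" for c
      using assms by (simp add: powr_def a_def mult.commute)
    moreover have "v powr (\<theta> + 1) = v * v powr \<theta>"
      using assms by (simp add: powr_add)
    moreover have "0 - (- v * W + \<theta> / (\<theta> + 1) * (v * W)) = v * W / (\<theta> + 1)" for W
      using assms by (simp add: add_pos_pos less_imp_neq[symmetric] field_simps)
    ultimately show ?thesis
      by (simp only:)
  qed
  finally show ?thesis .
qed

text \<open>Exponential tilting: the integrand is \<open>\<theta> / (\<theta> - s)\<close> times the
  exponential density of rate \<open>\<theta> - s\<close>, which has total mass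
  \<open>1\<close>.\<close>

lemma nn_integral_exponential_mgf:
  fixes \<theta> s :: real
  assumes "\<theta> > 0" "s < \<theta>"
  shows "(\<integral>\<^sup>+x. exponential_density \<theta> x * ennreal (exp (s * x)) \<partial>lborel) = ennreal (\<theta> / (\<theta> - s))"
proof -
  have eq: "exponential_density \<theta> x * ennreal (exp (s * x))
      = ennreal (\<theta> / (\<theta> - s)) * exponential_density (\<theta> - s) x" for x
  proof -
    have "exp (- x * \<theta>) * exp (s * x) = exp (- x * (\<theta> - s))"
      by (simp add: algebra_simps flip: exp_add)
    then show ?thesis
      using assms by (simp add: exponential_density_def flip: ennreal_mult')
  qed
  interpret e: prob_space "density lborel (exponential_density (\<theta> - s))"
    using assms by (intro prob_space_exponential_density) auto
  have "(\<integral>\<^sup>+x. exponential_density (\<theta> - s) x \<partial>lborel) = 1"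
    using e.emeasure_space_1 by (simp add: emeasure_density)
  then show ?thesis
    unfolding eq by (simp add: nn_integral_cmult)
qed

text \<open>The setting for one fixed horizon \<open>n\<close>. All bounds proved in it are
  non-asymptotic.\<close>

locale power_law_sample = prob_space M
  for M :: "'a measure" and n :: nat and X :: "nat \<Rightarrow> 'a \<Rightarrow> real" and x0 xF \<theta> :: real +
  assumes x0_nonneg: "0 \<le> x0" and x0_less: "x0 < xF" and theta_pos: "0 < \<theta>"
    and indep: "indep_vars (\<lambda>_. borel) X {1..n}"
    and cdf_X: "i \<in> {1..n} \<Longrightarrow> cdf (distr M borel (X i)) x = F_theta x0 xF \<theta> x"
begin

section \<open>Law of a single observation\<close>

lemma rv_X [measurable]: "i \<in> {1..n} \<Longrightarrow> X i \<in> borel_measurable M"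
  using indep by (auto simp: indep_vars_def2)

lemma prob_le: "i \<in> {1..n} \<Longrightarrow> prob {\<omega> \<in> space M. X i \<omega> \<le> x} = F_theta x0 xF \<theta> x"
  by (subst cdf_X[symmetric], assumption, unfold cdf_def, subst measure_distr)
    (auto intro!: arg_cong[where f = prob])

text \<open>This is the point at which \<open>phi x0 xF\<close> equals \<open>a\<close>; lying to
  the right of \<open>x0\<close>, it falls under the power-law branch of
  \<open>F_theta\<close>.\<close>

lemma quantile_bounds:
  assumes "0 \<le> a"
  shows "x0 \<le> xF - (xF - x0) * exp (- a)"
proof -
  have "xF - (xF - x0) * exp (- a) - x0 = (xF - x0) * (1 - exp (- a))"
    by (simp add: right_diff_distrib)
  also have "\<dots> \<ge> 0"
    using assms x0_less by simp
  finally show ?thesis by (simp only: diff_ge_0_iff_ge)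
qed

lemma prob_le_quantile:
  assumes "i \<in> {1..n}" "0 \<le> a"
  shows "prob {\<omega> \<in> space M. X i \<omega> \<le> xF - (xF - x0) * exp (- a)} = 1 - exp (- a * \<theta>)"
proof -
  have "exp (- a) powr \<theta> = exp (- a * \<theta>)"
    by (simp add: powr_def mult.commute)
  moreover have "x0 \<le> xF - (xF - x0) * exp (- a)"
    by (rule quantile_bounds[OF assms(2)])
  ultimately show ?thesis
    using x0_less assms by (simp add: prob_le F_theta_def)
qed

text \<open>The probability of reaching \<open>xF\<close> is at most
  \<open>exp (- a * \<theta>)\<close> for every \<open>a \<ge> 0\<close>, hence zero. Strictness
  matters because \<open>phi\<close> divides by \<open>xF - X i \<omega>\<close>.\<close>

lemma AE_less:
  assumes "i \<in> {1..n}"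
  shows "AE \<omega> in M. X i \<omega> < xF"
proof -
  have b: "prob {\<omega> \<in> space M. xF \<le> X i \<omega>} \<le> exp (- a * \<theta>)" if "0 \<le> a" for a
  proof -
    let ?b = "xF - (xF - x0) * exp (- a)"
    have "prob {\<omega> \<in> space M. xF \<le> X i \<omega>} \<le> prob (space M - {\<omega> \<in> space M. X i \<omega> \<le> ?b})"
    proof (rule finite_measure_mono)
      have "?b < xF" using x0_less by simp
      then show "{\<omega> \<in> space M. xF \<le> X i \<omega>} \<subseteq> space M - {\<omega> \<in> space M. X i \<omega> \<le> ?b}"
        by (auto simp del: less_diff_eq diff_less_eq)
    qed (use assms in measurable)
    also have "\<dots> = exp (- a * \<theta>)"
      using assms that by (subst prob_compl) (auto simp: prob_le_quantile)
    finally show ?thesis .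
  qed
  have "((\<lambda>a. exp (- a * \<theta>)) \<longlongrightarrow> 0) at_top"
    by (rule tendsto_exp_neg_mult_at_top[OF theta_pos])
  then have "prob {\<omega> \<in> space M. xF \<le> X i \<omega>} \<le> 0"
    by (rule tendsto_lowerbound) (auto intro!: eventually_mono[OF eventually_ge_at_top[of 0]] b[simplified])
  then have "prob {\<omega> \<in> space M. xF \<le> X i \<omega>} = 0"
    by (simp add: measure_le_0_iff)
  then show ?thesis
    using assms by (subst AE_iff_measurable[OF _ refl]) (auto simp: not_less emeasure_eq_measure)
qed

lemma AE_greater:
  assumes "i \<in> {1..n}"
  shows "AE \<omega> in M. x0 < X i \<omega>"
proof -
  have "prob {\<omega> \<in> space M. X i \<omega> \<le> x0} = 0"
    using assms x0_less by (simp add: prob_le F_theta_def)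
  then show ?thesis
    using assms by (subst AE_iff_measurable[OF _ refl]) (auto simp: not_less emeasure_eq_measure)
qed

lemma AE_bounds: "AE \<omega> in M. \<forall>i\<in>{1..n}. x0 < X i \<omega> \<and> X i \<omega> < xF"
  by (rule AE_finite_allI) (auto intro: AE_conjI AE_less AE_greater)

lemma measurable_phi [measurable]: "phi x0 xF \<in> borel_measurable borel"
  by (simp add: phi_def[abs_def])

text \<open>For \<open>a \<ge> 0\<close> the event that \<open>phi x0 xF (X i \<omega>)\<close> is
  at most \<open>a\<close> is the quantile event of \<open>prob_le_quantile\<close>, up to the null
  set where \<open>X i \<omega> < xF\<close> fails.\<close>

lemma distributed_phi:
  assumes i: "i \<in> {1..n}"
  shows "distributed M lborel (\<lambda>\<omega>. phi x0 xF (X i \<omega>)) (exponential_density \<theta>)"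
  unfolding exponential_distributed_iff[OF theta_pos]
proof (intro conjI allI impI)
  show "(\<lambda>\<omega>. phi x0 xF (X i \<omega>)) \<in> borel_measurable M"
    using i by measurable
  fix a :: real assume a: "0 \<le> a"
  have "prob {\<omega> \<in> space M. phi x0 xF (X i \<omega>) \<le> a}
      = prob {\<omega> \<in> space M. X i \<omega> \<le> xF - (xF - x0) * exp (- a)}"
  proof (rule prob_eq_AE)
    show "AE \<omega> in M. phi x0 xF (X i \<omega>) \<le> a \<longleftrightarrow> X i \<omega> \<le> xF - (xF - x0) * exp (- a)"
      using AE_less[OF i]
    proof eventually_elim
      case (elim \<omega>)
      have "phi x0 xF (X i \<omega>) \<le> a \<longleftrightarrow> (xF - x0) / (xF - X i \<omega>) \<le> exp a"
        using elim x0_less unfolding phi_def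
        by (subst exp_le_cancel_iff[symmetric]) (simp add: exp_ln)
      also have "\<dots> \<longleftrightarrow> X i \<omega> \<le> xF - (xF - x0) * exp (- a)"
        using elim x0_less by (simp add: field_simps exp_minus)
      finally show ?case .
    qed
  qed (use i in measurable)
  then show "prob {\<omega> \<in> space M. phi x0 xF (X i \<omega>) \<le> a} = 1 - exp (- a * \<theta>)"
    using prob_le_quantile[OF i a] by simp
qed

lemma integrable_max:
  assumes i: "i \<in> {1..n}"
  shows "integrable M (\<lambda>\<omega>. max (X i \<omega>) V)"
proof (rule integrable_const_bound[where B = "max \<bar>xF\<bar> \<bar>V\<bar> + \<bar>x0\<bar>"])
  show "AE \<omega> in M. norm (max (X i \<omega>) V) \<le> max \<bar>xF\<bar> \<bar>V\<bar> + \<bar>x0\<bar>"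
    using AE_less[OF i] AE_greater[OF i] by eventually_elim auto
qed (use i in measurable)

text \<open>The gain over the threshold is a function of \<open>phi x0 xF (X i)\<close>, which is exponentially
  distributed.\<close>

lemma expectation_max:
  assumes i: "i \<in> {1..n}" and V: "x0 \<le> V" "V < xF"
  shows "expectation (\<lambda>\<omega>. max (X i \<omega>) V)
    = V + (xF - V) powr (\<theta> + 1) / ((\<theta> + 1) * (xF - x0) powr \<theta>)"
proof -
  \<comment> \<open>The normalized gap of the threshold; \<open>X i \<omega> - V\<close> is
    \<open>xF - x0\<close> times the difference of \<open>v\<close> and the normalized gap of the
    observation.\<close>
  define v where "v = (xF - V) / (xF - x0)"
  have v: "0 < v" "v \<le> 1"
    using V x0_less by (auto simp: v_def field_simps)
  have [measurable]: "X i \<in> borel_measurable M" using i by simp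
  have "(\<integral>\<^sup>+\<omega>. ennreal (max (X i \<omega>) V - V) \<partial>M)
      = (\<integral>\<^sup>+\<omega>. ennreal (xF - x0) * ennreal (max 0 (v - exp (- phi x0 xF (X i \<omega>)))) \<partial>M)"
  proof (rule nn_integral_cong_AE)
    show "AE \<omega> in M. ennreal (max (X i \<omega>) V - V)
        = ennreal (xF - x0) * ennreal (max 0 (v - exp (- phi x0 xF (X i \<omega>))))"
      using AE_less[OF i]
    proof eventually_elim
      case (elim \<omega>)
      have "exp (- phi x0 xF (X i \<omega>)) = (xF - X i \<omega>) / (xF - x0)"
        using elim x0_less by (simp add: phi_def exp_minus)
      then have "(xF - x0) * (v - exp (- phi x0 xF (X i \<omega>))) = X i \<omega> - V"
        using x0_less by (simp only: v_def) (simp flip: diff_divide_distrib)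
      then have "(xF - x0) * max 0 (v - exp (- phi x0 xF (X i \<omega>))) = max (X i \<omega>) V - V"
        using max_mult_distrib_left[of "xF - x0" 0 "v - exp (- phi x0 xF (X i \<omega>))"] x0_less
        by (simp only:) simp
      then show ?case
        using x0_less by (metis diff_ge_0_iff_ge ennreal_mult' less_imp_le)
    qed
  qed
  also have "\<dots> = ennreal (xF - x0) * (\<integral>\<^sup>+\<omega>. ennreal (max 0 (v - exp (- phi x0 xF (X i \<omega>)))) \<partial>M)"
    by (rule nn_integral_cmult) simp
  also have "(\<integral>\<^sup>+\<omega>. ennreal (max 0 (v - exp (- phi x0 xF (X i \<omega>)))) \<partial>M)
      = ennreal (v powr (\<theta> + 1) / (\<theta> + 1))"
    using distributed_nn_integral[OF distributed_phi[OF i],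
        of "\<lambda>x. ennreal (max 0 (v - exp (- x)))"]
      nn_integral_exponential_excess[OF theta_pos v] by simp
  also have "ennreal (xF - x0) * \<dots>
      = ennreal ((xF - V) powr (\<theta> + 1) / ((\<theta> + 1) * (xF - x0) powr \<theta>))"
  proof -
    have "v powr (\<theta> + 1) = (xF - V) powr (\<theta> + 1) / ((xF - x0) * (xF - x0) powr \<theta>)"
      using V x0_less by (simp add: v_def powr_divide powr_add)
    then have "(xF - x0) * (v powr (\<theta> + 1) / (\<theta> + 1))
        = (xF - V) powr (\<theta> + 1) / ((\<theta> + 1) * (xF - x0) powr \<theta>)"
      using x0_less by simp
    then show ?thesis
      using x0_less by (metis diff_ge_0_iff_ge ennreal_mult' less_imp_le)
  qed
  finally have nn: "(\<integral>\<^sup>+\<omega>. ennreal (max (X i \<omega>) V - V) \<partial>M)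
    = ennreal ((xF - V) powr (\<theta> + 1) / ((\<theta> + 1) * (xF - x0) powr \<theta>))" .
  have "expectation (\<lambda>\<omega>. max (X i \<omega>) V - V)
      = (xF - V) powr (\<theta> + 1) / ((\<theta> + 1) * (xF - x0) powr \<theta>)"
    by (rule integral_eq_nn_integral[THEN trans]) (use theta_pos in \<open>auto simp: nn\<close>)
  then show ?thesis
    using integrable_max[OF i, of V] by (simp add: prob_space)
qed

text \<open>The case \<open>V = x0\<close> of \<open>expectation_max\<close>, where the maximum is
  almost surely \<open>X i\<close> itself.\<close>

lemma expectation_X:
  assumes i: "i \<in> {1..n}"
  shows "expectation (X i) = x0 + (xF - x0) / (\<theta> + 1)"
proof -
  have "expectation (X i) = expectation (\<lambda>\<omega>. max (X i \<omega>) x0)"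
    using AE_greater[OF i] i by (intro integral_cong_AE) (auto elim!: eventually_mono)
  also have "\<dots> = x0 + (xF - x0) / (\<theta> + 1)"
    using expectation_max[OF i order_refl x0_less] x0_less by (simp add: powr_add)
  finally show ?thesis .
qed

section \<open>Chernoff bounds for the sum behind the estimator\<close>

lemma measurable_sum_phi:
  "k \<le> n \<Longrightarrow> (\<lambda>\<omega>. \<Sum>i=1..k. phi x0 xF (X i \<omega>)) \<in> borel_measurable M"
  by (intro borel_measurable_sum measurable_compose[OF rv_X measurable_phi]) auto

lemma nn_expectation_exp_sum_phi:
  assumes "k \<le> n" "s < \<theta>"
  shows "(\<integral>\<^sup>+\<omega>. ennreal (exp (s * (\<Sum>i=1..k. phi x0 xF (X i \<omega>)))) \<partial>M) = ennreal ((\<theta> / (\<theta> - s)) ^ k)"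
proof -
  have "(\<integral>\<^sup>+\<omega>. ennreal (exp (s * (\<Sum>i=1..k. phi x0 xF (X i \<omega>)))) \<partial>M)
      = (\<integral>\<^sup>+\<omega>. (\<Prod>i\<in>{1..k}. ennreal (exp (s * phi x0 xF (X i \<omega>)))) \<partial>M)"
    by (simp add: exp_sum sum_distrib_left prod_ennreal)
  also have "\<dots> = (\<Prod>i\<in>{1..k}. \<integral>\<^sup>+\<omega>. ennreal (exp (s * phi x0 xF (X i \<omega>))) \<partial>M)"
  proof (rule indep_vars_nn_integral)
    have "indep_vars (\<lambda>_. borel) X {1..k}"
      by (rule indep_vars_subset[OF indep]) (use assms in auto)
    then show "indep_vars (\<lambda>_. borel) (\<lambda>i \<omega>. ennreal (exp (s * phi x0 xF (X i \<omega>)))) {1..k}"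
      by (rule indep_vars_compose2[where Y = "\<lambda>_ x. ennreal (exp (s * phi x0 xF x))"]) simp
  qed auto
  also have "\<dots> = (\<Prod>i\<in>{1..k}. ennreal (\<theta> / (\<theta> - s)))"
  proof (rule prod.cong[OF refl])
    fix i assume "i \<in> {1..k}"
    then have "i \<in> {1..n}" using assms by auto
    from distributed_nn_integral[OF distributed_phi[OF this], of "\<lambda>x. ennreal (exp (s * x))"]
    show "(\<integral>\<^sup>+\<omega>. ennreal (exp (s * phi x0 xF (X i \<omega>))) \<partial>M) = ennreal (\<theta> / (\<theta> - s))"
      using nn_integral_exponential_mgf[OF theta_pos assms(2)] by simp
  qed
  also have "\<dots> = ennreal ((\<theta> / (\<theta> - s)) ^ k)"
    using assms theta_pos by (simp add: ennreal_power)
  finally show ?thesis .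
qed

text \<open>Markov's inequality for the exponential of the sum. The factor \<open>s\<close> is kept
  on both sides of the event so that its sign selects the tail.\<close>

lemma chernoff_sum_phi:
  assumes "k \<le> n" "s < \<theta>"
  shows "prob {\<omega> \<in> space M. s * a \<le> s * (\<Sum>i=1..k. phi x0 xF (X i \<omega>))}
    \<le> exp (- s * a) * (\<theta> / (\<theta> - s)) ^ k"
proof -
  let ?S = "\<lambda>\<omega>. \<Sum>i=1..k. phi x0 xF (X i \<omega>)"
  have [measurable]: "?S \<in> borel_measurable M"
    using assms(1) by (rule measurable_sum_phi)
  have "emeasure M {\<omega> \<in> space M. s * a \<le> s * ?S \<omega>}
      \<le> emeasure M ({\<omega> \<in> space M. 1 \<le> ennreal (exp (- s * a)) * ennreal (exp (s * ?S \<omega>))} \<inter> space M)"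
  proof (rule emeasure_mono)
    show "{\<omega> \<in> space M. s * a \<le> s * ?S \<omega>} \<subseteq>
        {\<omega> \<in> space M. 1 \<le> ennreal (exp (- s * a)) * ennreal (exp (s * ?S \<omega>))} \<inter> space M"
      by (auto simp flip: ennreal_mult' exp_add)
  qed measurable
  also have "{\<omega> \<in> space M. 1 \<le> ennreal (exp (- s * a)) * ennreal (exp (s * ?S \<omega>))} \<inter> space M
      = {\<omega> \<in> space M. 1 \<le> ennreal (exp (- s * a)) * ennreal (exp (s * ?S \<omega>))}"
    by auto
  also have "emeasure M \<dots> \<le> ennreal (exp (- s * a)) * (\<integral>\<^sup>+\<omega>. ennreal (exp (s * ?S \<omega>)) * indicator (space M) \<omega> \<partial>M)"
    by (rule nn_integral_Markov_inequality) measurable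
  also have "(\<integral>\<^sup>+\<omega>. ennreal (exp (s * ?S \<omega>)) * indicator (space M) \<omega> \<partial>M) = ennreal ((\<theta> / (\<theta> - s)) ^ k)"
    unfolding nn_expectation_exp_sum_phi[OF assms, symmetric]
    by (intro nn_integral_cong) simp
  finally have "emeasure M {\<omega> \<in> space M. s * a \<le> s * ?S \<omega>} \<le> ennreal (exp (- s * a) * (\<theta> / (\<theta> - s)) ^ k)"
    by (simp add: ennreal_mult')
  then show ?thesis
    using assms theta_pos by (simp add: emeasure_eq_measure ennreal_le_iff)
qed

lemma sum_phi_upper_tail:
  assumes "k \<le> n" "0 < e"
  shows "prob {\<omega> \<in> space M. (1 + e) * real k / \<theta> < (\<Sum>i=1..k. phi x0 xF (X i \<omega>))}
    \<le> exp (real k * (ln (1 + e) - e))"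
proof -
  \<comment> \<open>The minimizer of the Chernoff bound at level
    \<open>(1 + e) * real k / \<theta>\<close>, characterized by
    \<open>\<theta> - s = \<theta> / (1 + e)\<close>.\<close>
  define s where "s = \<theta> * e / (1 + e)"
  have s: "0 < s" "s < \<theta>" "\<theta> / (\<theta> - s) = 1 + e" "s * ((1 + e) * real k / \<theta>) = real k * e"
  proof -
    show "0 < s" using assms theta_pos by (simp add: s_def)
    show "s < \<theta>" using assms theta_pos by (simp add: s_def field_simps)
    have "\<theta> - s = \<theta> / (1 + e)" using assms by (simp add: s_def field_simps)
    then show "\<theta> / (\<theta> - s) = 1 + e" using theta_pos by simp
    show "s * ((1 + e) * real k / \<theta>) = real k * e"
      using assms theta_pos by (simp add: s_def)
  qed
  have [measurable]: "(\<lambda>\<omega>. \<Sum>i=1..k. phi x0 xF (X i \<omega>)) \<in> borel_measurable M"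
    using assms(1) by (rule measurable_sum_phi)
  have "prob {\<omega> \<in> space M. (1 + e) * real k / \<theta> < (\<Sum>i=1..k. phi x0 xF (X i \<omega>))}
    \<le> prob {\<omega> \<in> space M. s * ((1 + e) * real k / \<theta>) \<le> s * (\<Sum>i=1..k. phi x0 xF (X i \<omega>))}"
  proof (rule finite_measure_mono)
    show "{\<omega> \<in> space M. (1 + e) * real k / \<theta> < (\<Sum>i=1..k. phi x0 xF (X i \<omega>))}
        \<subseteq> {\<omega> \<in> space M. s * ((1 + e) * real k / \<theta>) \<le> s * (\<Sum>i=1..k. phi x0 xF (X i \<omega>))}"
      using s(1) by (auto simp del: times_divide_eq_right)
  qed measurable
  also have "\<dots> \<le> exp (- s * ((1 + e) * real k / \<theta>)) * (\<theta> / (\<theta> - s)) ^ k"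
    by (rule chernoff_sum_phi) (use assms s in auto)
  also have "\<dots> = exp (real k * (ln (1 + e) - e))"
  proof -
    have "(1 + e) ^ k = exp (real k * ln (1 + e))"
      using assms by (simp add: exp_of_nat_mult)
    then show ?thesis
      unfolding s(3) mult_minus_left s(4) by (simp add: right_diff_distrib exp_diff exp_minus divide_inverse)
  qed
  finally show ?thesis .
qed

lemma sum_phi_lower_tail:
  assumes "k \<le> n" "0 < e" "e < 1"
  shows "prob {\<omega> \<in> space M. (\<Sum>i=1..k. phi x0 xF (X i \<omega>)) < (1 - e) * real k / \<theta>}
    \<le> exp (real k * (ln (1 - e) + e))"
proof -
  \<comment> \<open>Again the minimizer, now negative, with
    \<open>\<theta> - s = \<theta> / (1 - e)\<close>.\<close>
  define s where "s = - \<theta> * e / (1 - e)"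
  have s: "s < 0" "s < \<theta>" "\<theta> / (\<theta> - s) = 1 - e" "s * ((1 - e) * real k / \<theta>) = - real k * e"
  proof -
    show "s < 0" using assms theta_pos by (auto simp: s_def field_simps)
    then show "s < \<theta>" using theta_pos by simp
    have "\<theta> - s = \<theta> / (1 - e)" using assms by (simp add: s_def field_simps)
    then show "\<theta> / (\<theta> - s) = 1 - e" using theta_pos by simp
    show "s * ((1 - e) * real k / \<theta>) = - real k * e"
      using assms theta_pos by (simp add: s_def)
  qed
  have [measurable]: "(\<lambda>\<omega>. \<Sum>i=1..k. phi x0 xF (X i \<omega>)) \<in> borel_measurable M"
    using assms(1) by (rule measurable_sum_phi)
  have "prob {\<omega> \<in> space M. (\<Sum>i=1..k. phi x0 xF (X i \<omega>)) < (1 - e) * real k / \<theta>}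
    \<le> prob {\<omega> \<in> space M. s * ((1 - e) * real k / \<theta>) \<le> s * (\<Sum>i=1..k. phi x0 xF (X i \<omega>))}"
  proof (rule finite_measure_mono)
    show "{\<omega> \<in> space M. (\<Sum>i=1..k. phi x0 xF (X i \<omega>)) < (1 - e) * real k / \<theta>}
        \<subseteq> {\<omega> \<in> space M. s * ((1 - e) * real k / \<theta>) \<le> s * (\<Sum>i=1..k. phi x0 xF (X i \<omega>))}"
      using s(1) by (auto simp del: times_divide_eq_right)
  qed measurable
  also have "\<dots> \<le> exp (- s * ((1 - e) * real k / \<theta>)) * (\<theta> / (\<theta> - s)) ^ k"
    by (rule chernoff_sum_phi) (use assms s in auto)
  also have "\<dots> = exp (real k * (ln (1 - e) + e))"
  proof -
    have "(1 - e) ^ k = exp (real k * ln (1 - e))"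
      using assms by (simp add: exp_of_nat_mult)
    then show ?thesis
      unfolding s(3) using s(4) by (simp add: distrib_left exp_add mult.commute)
  qed
  finally show ?thesis .
qed

section \<open>Expected reward under fixed thresholds\<close>

lemma AE_abs_le:
  assumes "i \<in> {1..n}"
  shows "AE \<omega> in M. \<bar>X i \<omega>\<bar> \<le> xF"
  using AE_less[OF assms] AE_greater[OF assms] by eventually_elim (use x0_nonneg in auto)

text \<open>A single null set serves all thresholds \<open>c\<close>, as is required when
  \<open>c\<close> is later random.\<close>

lemma AE_threshold_reward_bounds:
  assumes "k < n"
  shows "AE \<omega> in M. \<forall>c. x0 \<le> threshold_reward c n (\<lambda>t. X t \<omega>) k
    \<and> threshold_reward c n (\<lambda>t. X t \<omega>) k \<le> xF"
  using AE_bounds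
proof eventually_elim
  case (elim \<omega>)
  show ?case
  proof
    fix c
    obtain i where "i \<in> {n - k..n}" "threshold_reward c n (\<lambda>t. X t \<omega>) k = X i \<omega>"
      using threshold_reward_in_image[of c n "\<lambda>t. X t \<omega>" k] by auto
    then show "x0 \<le> threshold_reward c n (\<lambda>t. X t \<omega>) k \<and> threshold_reward c n (\<lambda>t. X t \<omega>) k \<le> xF"
      using elim assms by (auto simp: less_imp_le)
  qed
qed

lemma measurable_threshold_reward_PiM:
  assumes "{n - k..n} \<subseteq> I"
  shows "(\<lambda>y. threshold_reward c n y k) \<in> borel_measurable (Pi\<^sub>M I (\<lambda>_. borel :: real measure))"
proof -
  \<comment> \<open>Fixed thresholds are the case of a one-point parameter space.\<close>
  have "(\<lambda>y. ((), y)) \<in> measurable (Pi\<^sub>M I (\<lambda>_. borel :: real measure)) (count_space UNIV \<Otimes>\<^sub>M Pi\<^sub>M I (\<lambda>_. borel))"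
    by simp
  from measurable_compose[OF this measurable_threshold_reward[OF assms, of "\<lambda>j _. c j"]]
  show ?thesis by simp
qed

lemma measurable_threshold_reward_sample:
  assumes "k < n"
  shows "(\<lambda>\<omega>. threshold_reward c n (\<lambda>t. X t \<omega>) k) \<in> borel_measurable M"
proof -
  have "(\<lambda>\<omega>. \<lambda>t\<in>{n - k..n}. X t \<omega>) \<in> measurable M (Pi\<^sub>M {n - k..n} (\<lambda>_. borel))"
    using assms by (intro measurable_restrict rv_X) auto
  from measurable_compose[OF this measurable_threshold_reward_PiM[OF order_refl, of c]]
  have "(\<lambda>\<omega>. threshold_reward c n (\<lambda>t\<in>{n - k..n}. X t \<omega>) k) \<in> borel_measurable M" .
  also have "(\<lambda>\<omega>. threshold_reward c n (\<lambda>t\<in>{n - k..n}. X t \<omega>) k)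
      = (\<lambda>\<omega>. threshold_reward c n (\<lambda>t. X t \<omega>) k)"
    by (intro ext threshold_reward_cong) auto
  finally show ?thesis .
qed

lemma integrable_threshold_reward:
  assumes "k < n"
  shows "integrable M (\<lambda>\<omega>. threshold_reward c n (\<lambda>t. X t \<omega>) k)"
proof (rule integrable_const_bound[OF _ measurable_threshold_reward_sample[OF assms]])
  show "AE \<omega> in M. norm (threshold_reward c n (\<lambda>t. X t \<omega>) k) \<le> xF"
    using AE_threshold_reward_bounds[OF assms]
  proof eventually_elim
    case (elim \<omega>)
    then have "x0 \<le> threshold_reward c n (\<lambda>t. X t \<omega>) k \<and> threshold_reward c n (\<lambda>t. X t \<omega>) k \<le> xF"
      by blast
    then show ?case using x0_nonneg by simp
  qed
qed

text \<open>One step of dynamic programming: rejection of the current observation is independent of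
  the later reward, so on that event the later reward may be replaced by a lower bound
  \<open>B\<close> of its mean.\<close>

lemma expectation_threshold_reward_Suc:
  assumes k: "Suc k < n" and B: "B \<le> expectation (\<lambda>\<omega>. threshold_reward c n (\<lambda>t. X t \<omega>) k)"
  shows "expectation (\<lambda>\<omega>. if c k \<le> X (n - Suc k) \<omega> then X (n - Suc k) \<omega> else B)
    \<le> expectation (\<lambda>\<omega>. threshold_reward c n (\<lambda>t. X t \<omega>) (Suc k))"
proof -
  let ?i = "n - Suc k" and ?R = "\<lambda>\<omega>. threshold_reward c n (\<lambda>t. X t \<omega>) k"
  let ?I = "\<lambda>\<omega>. indicator {..<c k} (X ?i \<omega>) :: real"
  let ?A = "\<lambda>\<omega>. if c k \<le> X ?i \<omega> then X ?i \<omega> else 0"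
  have i: "?i \<in> {1..n}" using k by auto
  have [measurable]: "X ?i \<in> borel_measurable M" using rv_X[OF i] .
  have "indep_var (Pi\<^sub>M {?i} (\<lambda>_. borel)) (\<lambda>\<omega>. \<lambda>t\<in>{?i}. X t \<omega>)
      (Pi\<^sub>M {n - k..n} (\<lambda>_. borel)) (\<lambda>\<omega>. \<lambda>t\<in>{n - k..n}. X t \<omega>)"
    by (rule indep_var_restrict[OF indep]) (use k in auto)
  then have "indep_var borel ((\<lambda>y. indicator {..<c k} (y ?i)) \<circ> (\<lambda>\<omega>. \<lambda>t\<in>{?i}. X t \<omega>))
      borel ((\<lambda>y. threshold_reward c n y k) \<circ> (\<lambda>\<omega>. \<lambda>t\<in>{n - k..n}. X t \<omega>))"
    by (rule indep_var_compose) (auto intro!: measurable_threshold_reward_PiM)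
  also have "(\<lambda>y. threshold_reward c n y k) \<circ> (\<lambda>\<omega>. \<lambda>t\<in>{n - k..n}. X t \<omega>) = ?R"
    by (auto simp: fun_eq_iff intro!: threshold_reward_cong)
  finally have ind: "indep_var borel ?I borel ?R"
    by (simp add: comp_def)
  have intI: "integrable M ?I"
    by (rule integrable_const_bound[where B = 1]) auto
  have intR: "integrable M ?R"
    by (rule integrable_threshold_reward) (use k in simp)
  have intA: "integrable M ?A"
  proof (rule integrable_const_bound[where B = xF])
    show "AE \<omega> in M. norm (?A \<omega>) \<le> xF"
      using AE_abs_le[OF i] by eventually_elim (use x0_nonneg x0_less in auto)
  qed measurable
  have "(if c k \<le> X ?i \<omega> then X ?i \<omega> else B) = ?A \<omega> + ?I \<omega> * B" for \<omega>
    by auto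
  then have "expectation (\<lambda>\<omega>. if c k \<le> X ?i \<omega> then X ?i \<omega> else B) = expectation ?A + expectation ?I * B"
    using intA intI by simp
  also have "\<dots> \<le> expectation ?A + expectation ?I * expectation ?R"
    using B by (intro add_left_mono mult_left_mono) auto
  also have "\<dots> = expectation ?A + expectation (\<lambda>\<omega>. ?I \<omega> * ?R \<omega>)"
    using indep_var_lebesgue_integral[OF ind intI intR] by simp
  also have "\<dots> = expectation (\<lambda>\<omega>. ?A \<omega> + ?I \<omega> * ?R \<omega>)"
    using intA indep_var_integrable[OF ind intI intR] by simp
  also have "\<dots> = expectation (\<lambda>\<omega>. threshold_reward c n (\<lambda>t. X t \<omega>) (Suc k))"
    by (intro Bochner_Integration.integral_cong) auto
  finally show ?thesis .
qed

text \<open>Induction on \<open>k\<close>: after a rejection the mean reward is at least the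
  threshold, so the policy earns at least the mean of the maximum of observation and threshold.
  Under \<theta> this mean dominates the next value of the recursion by
  \<open>V_rem_Suc_le\<close>.\<close>

lemma optimistic_reward_ge:
  assumes "k < n" "\<theta> \<le> \<eta>"
  shows "V_rem x0 xF \<eta> k \<le> expectation (\<lambda>\<omega>. threshold_reward (V_rem x0 xF \<eta>) n (\<lambda>t. X t \<omega>) k)"
  using assms(1)
proof (induction k)
  case 0
  then have "expectation (X n) = x0 + (xF - x0) / (\<theta> + 1)"
    by (intro expectation_X) auto
  moreover have "(xF - x0) / (\<eta> + 1) \<le> (xF - x0) / (\<theta> + 1)"
    using assms x0_less theta_pos by (intro divide_left_mono) auto
  ultimately show ?case by simp
next
  case (Suc k)
  let ?V = "V_rem x0 xF \<eta> k"
  have V: "x0 \<le> ?V" "?V < xF"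
    using V_rem_bounds[OF x0_less, of \<eta> k] assms theta_pos by auto
  have "V_rem x0 xF \<eta> (Suc k) \<le> expectation (\<lambda>\<omega>. max (X (n - Suc k) \<omega>) ?V)"
    using V_rem_Suc_le[OF x0_less theta_pos assms(2), of k] expectation_max[OF _ V, of "n - Suc k"]
      Suc.prems by simp
  \<comment> \<open>The acceptance rule selects the maximum because the threshold equals the
    guaranteed continuation value.\<close>
  also have "\<dots> = expectation (\<lambda>\<omega>. if ?V \<le> X (n - Suc k) \<omega> then X (n - Suc k) \<omega> else ?V)"
    by (intro Bochner_Integration.integral_cong) auto
  also have "\<dots> \<le> expectation (\<lambda>\<omega>. threshold_reward (V_rem x0 xF \<eta>) n (\<lambda>t. X t \<omega>) (Suc k))"
    using Suc by (intro expectation_threshold_reward_Suc) auto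
  finally show ?case .
qed

text \<open>An accepted observation is worth at least its threshold, hence at least
  \<open>B\<close>, and the last one is worth at least \<open>B\<close> on average. The thresholds
  need not come from an overestimate of \<theta>.\<close>

lemma threshold_reward_ge:
  assumes "k < n" "\<And>j. j < k \<Longrightarrow> B \<le> c j" "B \<le> expectation (X n)"
  shows "B \<le> expectation (\<lambda>\<omega>. threshold_reward c n (\<lambda>t. X t \<omega>) k)"
  using assms(1,2)
proof (induction k)
  case 0
  show ?case using assms(3) by simp
next
  case (Suc k)
  have i: "n - Suc k \<in> {1..n}" using Suc.prems by auto
  have [measurable]: "X (n - Suc k) \<in> borel_measurable M" using rv_X[OF i] .
  have "B = expectation (\<lambda>_. B)"
    by (simp add: prob_space)
  also have "\<dots> \<le> expectation (\<lambda>\<omega>. if c k \<le> X (n - Suc k) \<omega> then X (n - Suc k) \<omega> else B)"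
  proof (rule integral_mono)
    show "integrable M (\<lambda>\<omega>. if c k \<le> X (n - Suc k) \<omega> then X (n - Suc k) \<omega> else B)"
    proof (rule integrable_const_bound[where B = "xF + \<bar>B\<bar>"])
      show "AE \<omega> in M. norm (if c k \<le> X (n - Suc k) \<omega> then X (n - Suc k) \<omega> else B) \<le> xF + \<bar>B\<bar>"
        using AE_abs_le[OF i] by eventually_elim (use x0_nonneg x0_less in auto)
    qed measurable
  qed (use Suc.prems(2)[of k] in auto)
  also have "\<dots> \<le> expectation (\<lambda>\<omega>. threshold_reward c n (\<lambda>t. X t \<omega>) (Suc k))"
    using Suc by (intro expectation_threshold_reward_Suc) auto
  finally show ?case .
qed

text \<open>The estimate is a function of the first \<open>m\<close> observations and the reward for
  given thresholds one of the remaining observations. By independence a bound for each constant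
  \<open>\<eta>\<close> in \<open>A\<close> suffices.\<close>

lemma policy_reward_ge:
  assumes m: "m < n" and A: "A \<in> sets borel" and L: "0 \<le> L"
    "\<And>\<eta>. \<eta> \<in> A \<Longrightarrow> L \<le> expectation (\<lambda>\<omega>. threshold_reward (V_rem x0 xF \<eta>) n (\<lambda>t. X t \<omega>) (n - m - 1))"
  shows "prob {\<omega> \<in> space M. theta_U x0 xF m \<delta> (\<lambda>t. X t \<omega>) \<in> A} * L
    \<le> expectation (\<lambda>\<omega>. X (cdp_ol x0 xF n m \<delta> (\<lambda>t. X t \<omega>)) \<omega>)"
proof -
  let ?k = "n - m - 1" and ?S = "Pi\<^sub>M {1..m} (\<lambda>_. borel) :: (nat \<Rightarrow> real) measure"
  let ?\<eta> = "theta_U x0 xF m \<delta>"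
  let ?Z = "\<lambda>\<omega>. \<lambda>t\<in>{1..m}. X t \<omega>" and ?W = "\<lambda>\<omega>. \<lambda>t\<in>{m + 1..n}. X t \<omega>"
  let ?f = "\<lambda>\<eta> y. threshold_reward (V_rem x0 xF \<eta>) n y ?k"
  have nk: "{n - ?k..n} \<subseteq> {m + 1..n}" using m by auto
  have fW: "?f \<eta> (?W \<omega>) = ?f \<eta> (\<lambda>t. X t \<omega>)" for \<eta> \<omega>
    using nk by (intro threshold_reward_cong) (auto simp: restrict_def)
  have Z: "?\<eta> (?Z \<omega>) = ?\<eta> (\<lambda>t. X t \<omega>)" for \<omega>
    by (simp add: theta_U_def theta_hat_def)
  have m\<eta> [measurable]: "?\<eta> \<in> borel_measurable ?S"
    unfolding theta_U_def[abs_def] theta_hat_def[abs_def] by measurable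
  have mZ: "?Z \<in> measurable M ?S"
    using m by (intro measurable_restrict rv_X) auto
  have ind: "indep_var ?S ?Z (Pi\<^sub>M {m + 1..n} (\<lambda>_. borel)) ?W"
    by (rule indep_var_restrict[OF indep]) (use m in auto)
  have ev: "{\<omega> \<in> space M. ?\<eta> (\<lambda>t. X t \<omega>) \<in> A} = {\<omega> \<in> space M. ?Z \<omega> \<in> {z \<in> space ?S. ?\<eta> z \<in> A}}"
    using measurable_space[OF mZ] by (simp only: Z mem_Collect_eq) auto
  have "prob {\<omega> \<in> space M. ?Z \<omega> \<in> {z \<in> space ?S. ?\<eta> z \<in> A}} * L
      \<le> expectation (\<lambda>\<omega>. ?f (?\<eta> (?Z \<omega>)) (?W \<omega>))"
  proof (rule indep_var_expectation_ge[OF ind])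
    show "(\<lambda>p. ?f (?\<eta> (fst p)) (snd p)) \<in> borel_measurable (?S \<Otimes>\<^sub>M Pi\<^sub>M {m + 1..n} (\<lambda>_. borel))"
      using measurable_compose[OF m\<eta> measurable_V_rem]
      by (intro measurable_threshold_reward[OF nk, of "\<lambda>j z. V_rem x0 xF (?\<eta> z) j"])
    show "{z \<in> space ?S. ?\<eta> z \<in> A} \<in> sets ?S"
      using A by measurable
    show "AE \<omega> in M. \<forall>z. 0 \<le> ?f (?\<eta> z) (?W \<omega>) \<and> ?f (?\<eta> z) (?W \<omega>) \<le> xF"
      unfolding fW using AE_threshold_reward_bounds[of ?k] m x0_nonneg
      by (auto elim!: eventually_mono intro: order_trans)
    show "L \<le> expectation (\<lambda>\<omega>. ?f (?\<eta> z) (?W \<omega>))" if "z \<in> {z \<in> space ?S. ?\<eta> z \<in> A}" for z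
      unfolding fW using L(2) that by blast
  qed (rule L(1))
  also have "\<dots> = expectation (\<lambda>\<omega>. X (cdp_ol x0 xF n m \<delta> (\<lambda>t. X t \<omega>)) \<omega>)"
  proof (rule Bochner_Integration.integral_cong[OF refl])
    fix \<omega>
    have "?f (?\<eta> (?Z \<omega>)) (?W \<omega>) = ?f (?\<eta> (\<lambda>t. X t \<omega>)) (\<lambda>t. X t \<omega>)"
      by (simp only: fW Z)
    also have "\<dots> = X (cdp_ol x0 xF n m \<delta> (\<lambda>t. X t \<omega>)) \<omega>"
      by (rule cdp_ol_eq_threshold_reward[OF m, where x = "\<lambda>t. X t \<omega>", symmetric])
    finally show "?f (?\<eta> (?Z \<omega>)) (?W \<omega>) = X (cdp_ol x0 xF n m \<delta> (\<lambda>t. X t \<omega>)) \<omega>" .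
  qed
  finally show ?thesis
    by (simp only: ev)
qed

text \<open>The upper bound replaces \<open>OPT\<close> in the competitive ratio; positivity, from
  the positive mean of \<open>X 1\<close>, makes division by \<open>OPT\<close> monotone.\<close>

lemma OPT_bounds:
  assumes "0 < n"
  shows "0 < OPT M n X" "OPT M n X \<le> xF"
proof -
  let ?Mx = "\<lambda>\<omega>. Max ((\<lambda>t. X t \<omega>) ` {1..n})"
  have ne: "{1..n} \<noteq> {}" using assms by auto
  have "AE \<omega> in M. X 1 \<omega> \<le> ?Mx \<omega> \<and> ?Mx \<omega> \<le> xF \<and> x0 \<le> ?Mx \<omega>"
    using AE_bounds
  proof eventually_elim
    case (elim \<omega>)
    have "X 1 \<omega> \<le> ?Mx \<omega>" using assms by (intro Max_ge) auto
    moreover have "?Mx \<omega> \<le> xF" using ne elim by (subst Max_le_iff) (auto simp: less_imp_le)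
    moreover have "x0 \<le> X 1 \<omega>" using elim assms by (auto simp: less_imp_le)
    ultimately show ?case by auto
  qed
  then have AE: "AE \<omega> in M. X 1 \<omega> \<le> ?Mx \<omega>" "AE \<omega> in M. ?Mx \<omega> \<le> xF" "AE \<omega> in M. norm (?Mx \<omega>) \<le> xF"
    by (eventually_elim, use x0_nonneg in \<open>simp add: abs_le_iff\<close>)+
  have "?Mx \<in> borel_measurable M"
    using ne by (intro borel_measurable_Max) auto
  then have int: "integrable M ?Mx"
    by (rule integrable_const_bound[OF AE(3)])
  have "OPT M n X \<le> expectation (\<lambda>_. xF)"
    unfolding OPT_def using int AE(2) by (intro integral_mono_AE) auto
  then show "OPT M n X \<le> xF" by (simp add: prob_space)
  have "1 \<in> {1..n}" using assms by auto
  have int1: "integrable M (X 1)"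
    using AE_abs_le[OF \<open>1 \<in> {1..n}\<close>] assms by (intro integrable_const_bound[where B = xF]) auto
  have "expectation (X 1) \<le> OPT M n X"
    unfolding OPT_def by (rule integral_mono_AE[OF int1 int AE(1)])
  moreover have "expectation (X 1) > 0"
    using expectation_X[OF \<open>1 \<in> {1..n}\<close>] x0_nonneg x0_less theta_pos
    by (simp add: add_nonneg_pos)
  ultimately show "0 < OPT M n X" by simp
qed

section \<open>Competitive ratio\<close>

lemma sets_theta_U:
  assumes "m \<le> n" "A \<in> sets borel"
  shows "{\<omega> \<in> space M. theta_U x0 xF m \<delta> (\<lambda>t. X t \<omega>) \<in> A} \<in> events"
proof -
  have [measurable]: "(\<lambda>\<omega>. \<Sum>i=1..m. phi x0 xF (X i \<omega>)) \<in> borel_measurable M"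
    using assms(1) by (rule measurable_sum_phi)
  have [measurable]: "A \<in> sets borel" by (rule assms(2))
  show ?thesis
    unfolding theta_U_def theta_hat_def by measurable
qed

text \<open>Outside the two tail events the sum lies within a factor \<open>1 - \<epsilon>\<close>
  to \<open>1 + \<epsilon>\<close> of \<open>real m / \<theta>\<close>, and inverting gives the
  interval for \<open>theta_U\<close>. The upper tail is responsible for underestimates, the lower
  tail for overestimates.\<close>

lemma prob_theta_U_concentrated:
  assumes m: "0 < m" "m \<le> n" and \<delta>: "0 < \<delta>" "\<delta> < 1" and e: "eps m \<delta> \<le> 1 / 2"
  defines "\<epsilon> \<equiv> eps m \<delta>"
  shows "1 - \<delta> \<le> prob {\<omega> \<in> space M. theta_U x0 xF m \<delta> (\<lambda>t. X t \<omega>) \<in> {\<theta>..\<theta> * (1 + \<epsilon>) / (1 - \<epsilon>)}}"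
proof -
  let ?S = "\<lambda>\<omega>. \<Sum>i=1..m. phi x0 xF (X i \<omega>)"
  let ?G = "{\<omega> \<in> space M. theta_U x0 xF m \<delta> (\<lambda>t. X t \<omega>) \<in> {\<theta>..\<theta> * (1 + \<epsilon>) / (1 - \<epsilon>)}}"
  let ?U = "{\<omega> \<in> space M. (1 + \<epsilon>) * real m / \<theta> < ?S \<omega>}"
  let ?L = "{\<omega> \<in> space M. ?S \<omega> < (1 - \<epsilon>) * real m / \<theta>}"
  have [measurable]: "?S \<in> borel_measurable M"
    using m(2) by (rule measurable_sum_phi)
  have ev: "?U \<in> events" "?L \<in> events" by measurable
  have G: "?G \<in> events" using m(2) by (intro sets_theta_U) auto
  have l: "0 < ln (2 / \<delta>)" using \<delta> by simp
  then have \<epsilon>: "0 < \<epsilon>" "\<epsilon> \<le> 1 / 2" using m e by (auto simp: \<epsilon>_def eps_def)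
  \<comment> \<open>This identity is the reason for the form of \<open>eps\<close>: each tail
    receives probability at most \<open>\<delta> / 2\<close>.\<close>
  have "real m * (\<epsilon>\<^sup>2 / 4) = ln (2 / \<delta>)"
    using l m by (simp add: \<epsilon>_def eps_def)
  then have half: "exp (- (real m * (\<epsilon>\<^sup>2 / 4))) = \<delta> / 2"
    using \<delta> by (simp add: exp_minus)
  have "prob ?U \<le> exp (real m * (ln (1 + \<epsilon>) - \<epsilon>))"
    by (rule sum_phi_upper_tail) (use m \<epsilon> in auto)
  also have "\<dots> \<le> exp (real m * - (\<epsilon>\<^sup>2 / 4))"
    using ln_one_plus_le[of \<epsilon>] \<epsilon> by (subst exp_le_cancel_iff, intro mult_left_mono) auto
  finally have U: "prob ?U \<le> \<delta> / 2" using half by simp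
  have "prob ?L \<le> exp (real m * (ln (1 - \<epsilon>) + \<epsilon>))"
    by (rule sum_phi_lower_tail) (use m \<epsilon> in auto)
  also have "\<dots> \<le> exp (real m * - (\<epsilon>\<^sup>2 / 4))"
    using ln_one_minus_le[of \<epsilon>] \<epsilon> by (subst exp_le_cancel_iff, intro mult_left_mono) auto
  finally have L: "prob ?L \<le> \<delta> / 2" using half by simp
  have "space M - ?G \<subseteq> ?U \<union> ?L"
  proof
    fix \<omega> assume \<omega>: "\<omega> \<in> space M - ?G"
    show "\<omega> \<in> ?U \<union> ?L"
    proof (rule ccontr)
      assume "\<omega> \<notin> ?U \<union> ?L"
      with \<omega> have S: "?S \<omega> \<le> (1 + \<epsilon>) * real m / \<theta>" "(1 - \<epsilon>) * real m / \<theta> \<le> ?S \<omega>"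
        by (auto simp: not_less)
      have "0 < (1 - \<epsilon>) * real m / \<theta>" using m \<epsilon> theta_pos by simp
      with S(2) have pos: "0 < ?S \<omega>" by linarith
      have "\<theta> * ?S \<omega> \<le> (1 + \<epsilon>) * real m" "(1 - \<epsilon>) * real m \<le> \<theta> * ?S \<omega>"
        using S theta_pos by (auto simp: pos_le_divide_eq pos_divide_le_eq mult.commute)
      moreover have "(1 + \<epsilon>) * ((1 - \<epsilon>) * real m) \<le> (1 + \<epsilon>) * (\<theta> * ?S \<omega>)"
        using calculation(2) \<epsilon> by (intro mult_left_mono) auto
      ultimately have "\<theta> \<le> (1 + \<epsilon>) * (real m / ?S \<omega>)"
        "(1 + \<epsilon>) * (real m / ?S \<omega>) \<le> \<theta> * (1 + \<epsilon>) / (1 - \<epsilon>)"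
        using pos \<epsilon> by (simp_all add: pos_le_divide_eq pos_divide_le_eq mult.assoc mult.left_commute mult.commute)
      then have "\<omega> \<in> ?G"
        using \<omega> by (simp add: theta_U_def theta_hat_def \<epsilon>_def)
      then show False using \<omega> by blast
    qed
  qed
  then have "prob (space M - ?G) \<le> prob (?U \<union> ?L)"
    by (rule finite_measure_mono) (rule sets.Un[OF ev])
  also have "\<dots> \<le> prob ?U + prob ?L"
    by (rule measure_Un_le[OF ev])
  finally show ?thesis
    using U L prob_compl[OF G] by linarith
qed

text \<open>For \<open>\<delta> \<ge> 1 / 2\<close>, \<open>4 * ln (2 / \<delta>)\<close> is at most
  \<open>8\<close>, so \<open>eps\<close> is at most \<open>3\<close> even for \<open>m = 1\<close>.
  The lower tail with deviation \<open>1 / 2\<close> gives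
  \<open>theta_hat \<le> 2 * \<theta>\<close>, whence the factor \<open>4 * 2 = 8\<close> and the
  exponent \<open>(1 / 2)^2 / 4 = 1 / 16\<close>.\<close>

lemma prob_theta_U_le:
  assumes m: "0 < m" "m \<le> n" and \<delta>: "1 / 2 \<le> \<delta>" "\<delta> < 1"
  shows "1 - exp (- (1 / 16)) \<le> prob {\<omega> \<in> space M. theta_U x0 xF m \<delta> (\<lambda>t. X t \<omega>) \<in> {0<..8 * \<theta>}}"
proof -
  let ?S = "\<lambda>\<omega>. \<Sum>i=1..m. phi x0 xF (X i \<omega>)"
  let ?G = "{\<omega> \<in> space M. theta_U x0 xF m \<delta> (\<lambda>t. X t \<omega>) \<in> {0<..8 * \<theta>}}"
  let ?L = "{\<omega> \<in> space M. ?S \<omega> < (1 - 1 / 2) * real m / \<theta>}"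
  have [measurable]: "?S \<in> borel_measurable M"
    using m(2) by (rule measurable_sum_phi)
  have L: "?L \<in> events" by measurable
  have G: "?G \<in> events" using m(2) by (intro sets_theta_U) auto
  have "0 < ln (2 / \<delta>)" using \<delta> by simp
  moreover have "ln (2 / \<delta>) \<le> 2"
  proof -
    have "ln (2 / \<delta>) \<le> ln (2 * 2)"
      using \<delta> by (subst ln_le_cancel_iff) (auto simp: divide_le_eq)
    also have "\<dots> \<le> 2" using ln_2_less_1 by (subst ln_mult) auto
    finally show ?thesis .
  qed
  moreover have "4 * ln (2 / \<delta>) / real m \<le> 4 * ln (2 / \<delta>) / 1"
    using m calculation by (intro divide_left_mono) auto
  ultimately have "4 * ln (2 / \<delta>) / real m \<le> 3\<^sup>2" "0 \<le> 4 * ln (2 / \<delta>) / real m" by auto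
  then have e: "0 \<le> eps m \<delta>" "eps m \<delta> \<le> 3"
    unfolding eps_def by (auto intro: real_le_lsqrt)
  have "space M - ?G \<subseteq> ?L"
  proof
    fix \<omega> assume \<omega>: "\<omega> \<in> space M - ?G"
    show "\<omega> \<in> ?L"
    proof (rule ccontr)
      assume "\<omega> \<notin> ?L"
      with \<omega> have S: "(1 - 1 / 2) * real m / \<theta> \<le> ?S \<omega>"
        by (auto simp: not_less)
      have "0 < (1 - 1 / 2) * real m / \<theta>" using m theta_pos by simp
      with S have pos: "0 < ?S \<omega>" by linarith
      have "real m \<le> 2 * \<theta> * ?S \<omega>"
        using S theta_pos by (simp add: field_simps)
      then have "real m / ?S \<omega> \<le> 2 * \<theta>"
        using pos by (simp add: pos_divide_le_eq)
      then have "(1 + eps m \<delta>) * (real m / ?S \<omega>) \<le> 4 * (2 * \<theta>)"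
        using e pos by (intro mult_mono) auto
      moreover have "0 < (1 + eps m \<delta>) * (real m / ?S \<omega>)"
        using e pos m by (intro mult_pos_pos) auto
      ultimately have "\<omega> \<in> ?G"
        using \<omega> by (simp add: theta_U_def theta_hat_def)
      then show False using \<omega> by blast
    qed
  qed
  then have "prob (space M - ?G) \<le> prob ?L"
    using L by (intro finite_measure_mono) auto
  also have "\<dots> \<le> exp (real m * (ln (1 - 1 / 2) + 1 / 2))"
    by (rule sum_phi_lower_tail) (use m in auto)
  also have "\<dots> \<le> exp (- (1 / 16))"
  proof -
    have l: "ln (1 - 1 / 2) + 1 / 2 \<le> - (1 / 16 :: real)"
      using ln_one_minus_le[of "1 / 2"] by (simp add: power2_eq_square)
    have "real m * (ln (1 - 1 / 2) + 1 / 2) \<le> real m * - (1 / 16)"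
      using l by (intro mult_left_mono) auto
    also have "\<dots> \<le> - (1 / 16)" using m by simp
    finally show ?thesis by (simp only: exp_le_cancel_iff)
  qed
  finally show ?thesis
    using prob_compl[OF G] by linarith
qed

section \<open>From expected reward to competitive ratio\<close>

lemma CR_ge:
  assumes "0 < n" "0 \<le> v" "v \<le> expectation (\<lambda>\<omega>. X (\<tau> \<omega>) \<omega>)"
  shows "v / xF \<le> CR M n X \<tau>"
proof -
  have "v / xF \<le> v / OPT M n X"
    using OPT_bounds[OF assms(1)] assms(2) by (intro divide_left_mono) auto
  also have "\<dots> \<le> CR M n X \<tau>"
    unfolding CR_def using OPT_bounds[OF assms(1)] assms(3) by (intro divide_right_mono) auto
  finally show ?thesis .
qed

text \<open>When \<open>theta_U\<close> is in \<open>{0<..8 * \<theta>}\<close>, all thresholds and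
  the mean of the last observation are at least \<open>?B\<close>. The resulting bound does not
  depend on \<open>n\<close>, \<open>m\<close> or \<open>\<delta>\<close>.\<close>

lemma CR_ge_const:
  assumes m: "0 < m" "m < n" and \<delta>: "1 / 2 \<le> \<delta>" "\<delta> < 1"
  shows "(1 - exp (- (1 / 16))) * (x0 + (xF - x0) / (8 * \<theta> + 1)) / xF
    \<le> CR M n X (\<lambda>\<omega>. cdp_ol x0 xF n m \<delta> (\<lambda>t. X t \<omega>))"
proof -
  let ?B = "x0 + (xF - x0) / (8 * \<theta> + 1)"
  let ?P = "prob {\<omega> \<in> space M. theta_U x0 xF m \<delta> (\<lambda>t. X t \<omega>) \<in> {0<..8 * \<theta>}}"
  have B0: "0 \<le> ?B" using x0_nonneg x0_less theta_pos by simp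
  have mono: "?B \<le> x0 + (xF - x0) / (\<eta> + 1)" if "0 < \<eta>" "\<eta> \<le> 8 * \<theta>" for \<eta>
    using that x0_less by (simp add: frac_le)
  have "(1 - exp (- (1 / 16))) * ?B \<le> ?P * ?B"
    using prob_theta_U_le[OF m(1) _ \<delta>] m B0 by (intro mult_right_mono) auto
  also have "\<dots> \<le> expectation (\<lambda>\<omega>. X (cdp_ol x0 xF n m \<delta> (\<lambda>t. X t \<omega>)) \<omega>)"
  proof (rule policy_reward_ge[OF m(2) _ B0])
    fix \<eta> assume "\<eta> \<in> {0<..8 * \<theta>}"
    then have \<eta>: "0 < \<eta>" "\<eta> \<le> 8 * \<theta>" by auto
    show "?B \<le> expectation (\<lambda>\<omega>. threshold_reward (V_rem x0 xF \<eta>) n (\<lambda>t. X t \<omega>) (n - m - 1))"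
    proof (rule threshold_reward_ge)
      show "?B \<le> V_rem x0 xF \<eta> j" for j
        using mono[OF \<eta>] V_rem_ge_0[OF \<eta>(1), of x0 xF j] by simp
      have "expectation (X n) = x0 + (xF - x0) / (\<theta> + 1)"
        using m by (intro expectation_X) auto
      then show "?B \<le> expectation (X n)"
        using mono[of \<theta>] theta_pos by simp
    qed (use m in auto)
  qed simp
  finally show ?thesis
    using m B0 by (intro CR_ge) auto
qed

text \<open>On the concentration event the gap of the thresholds has exponent
  \<open>1 / \<eta>\<close>. Passing to \<open>1 / \<theta>\<close> costs a factor
  \<open>n powr (2 * \<epsilon> / \<theta>)\<close>, at most \<open>exp (2 / \<theta>)\<close>
  because \<open>\<epsilon> * ln n \<le> 1\<close>.\<close>

lemma CR_ge_rate:
  assumes m: "0 < m" "2 * m \<le> n" and \<delta>: "0 < \<delta>" "\<delta> < 1"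
    and e: "eps m \<delta> \<le> 1 / 2" "eps m \<delta> * ln (real n) \<le> 1"
  shows "(1 - \<delta>) * (1 - (2 * (\<theta> + 1) / \<theta>) powr (1 / \<theta>) * exp (2 / \<theta>) * real n powr (- (1 / \<theta>)))
    \<le> CR M n X (\<lambda>\<omega>. cdp_ol x0 xF n m \<delta> (\<lambda>t. X t \<omega>))"
proof -
  define \<epsilon> where "\<epsilon> = eps m \<delta>"
  \<comment> \<open>The factor \<open>2\<close> accounts for
    \<open>n - m \<ge> n / 2\<close>.\<close>
  define K where "K = 2 * (\<theta> + 1) / \<theta>"
  define g where "g = K powr (1 / \<theta>) * exp (2 / \<theta>) * real n powr (- (1 / \<theta>))"
  \<comment> \<open>Truncated at \<open>0\<close> because both \<open>policy_reward_ge\<close> and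
    \<open>CR_ge\<close> require a nonnegative bound.\<close>
  define v where "v = max 0 (xF - (xF - x0) * g)"
  let ?A = "{\<theta>..\<theta> * (1 + \<epsilon>) / (1 - \<epsilon>)}"
  have mn: "m < n" "0 < n" using m by auto
  have \<epsilon>: "0 \<le> \<epsilon>" "\<epsilon> \<le> 1 / 2" "\<epsilon> * ln (real n) \<le> 1"
    using e \<delta> m by (auto simp: \<epsilon>_def eps_def)
  have K: "1 \<le> K" using theta_pos by (simp add: K_def le_divide_eq)
  have gap: "((\<eta> + 1) / (\<eta> * real (n - m - 1 + 1))) powr (1 / \<eta>) \<le> g" if "\<eta> \<in> ?A" for \<eta>
  proof -
    have \<eta>: "\<theta> \<le> \<eta>" "\<eta> * (1 - \<epsilon>) \<le> \<theta> * (1 + \<epsilon>)" "0 < \<eta>"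
      using that \<epsilon> theta_pos by (auto simp: pos_le_divide_eq)
    have "1 + 1 / \<eta> \<le> 1 + 1 / \<theta>"
      using \<eta> theta_pos by (simp add: frac_le)
    then have r: "(\<eta> + 1) / \<eta> \<le> (\<theta> + 1) / \<theta>"
      using \<eta> theta_pos by (simp add: add_divide_distrib)
    have N: "real n / 2 \<le> real (n - m - 1 + 1)"
      using m by (simp add: of_nat_diff)
    have "(\<eta> + 1) / (\<eta> * real (n - m - 1 + 1)) = (\<eta> + 1) / \<eta> / real (n - m - 1 + 1)"
      by simp
    also have "\<dots> \<le> (\<theta> + 1) / \<theta> / (real n / 2)"
      by (rule frac_le[OF _ r _ N]) (use mn theta_pos in auto)
    also have "\<dots> = K / real n"
      by (simp add: K_def)
    finally have "((\<eta> + 1) / (\<eta> * real (n - m - 1 + 1))) powr (1 / \<eta>) \<le> (K / real n) powr (1 / \<eta>)"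
      using \<eta> by (intro powr_mono2) auto
    also have "\<dots> = K powr (1 / \<eta>) * real n powr (- (1 / \<eta>))"
      using K mn by (simp add: powr_divide powr_minus_divide)
    also have "\<dots> \<le> K powr (1 / \<theta>) * (exp (2 / \<theta>) * real n powr (- (1 / \<theta>)))"
    proof (rule mult_mono)
      show "K powr (1 / \<eta>) \<le> K powr (1 / \<theta>)"
        using K \<eta> theta_pos by (intro powr_mono) (auto simp: frac_le)
      have "(1 - 2 * \<epsilon>) / \<theta> \<le> 1 / \<eta>"
      proof -
        \<comment> \<open>The difference of the two sides is \<open>2 * \<epsilon>^2\<close>; this
          linearizes
          \<open>(1 - \<epsilon>) / (1 + \<epsilon>) \<ge> 1 - 2 * \<epsilon>\<close>.\<close>
        have "(1 - 2 * \<epsilon>) * (1 + \<epsilon>) \<le> 1 - \<epsilon>"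
          using \<epsilon> by (simp add: algebra_simps)
        then have "\<eta> * ((1 - 2 * \<epsilon>) * (1 + \<epsilon>)) \<le> \<eta> * (1 - \<epsilon>)"
          using \<eta> by (intro mult_left_mono) auto
        also have "\<dots> \<le> \<theta> * (1 + \<epsilon>)" by (rule \<eta>(2))
        finally have "(\<eta> * (1 - 2 * \<epsilon>)) * (1 + \<epsilon>) \<le> \<theta> * (1 + \<epsilon>)"
          by (simp add: mult.assoc)
        then have "\<eta> * (1 - 2 * \<epsilon>) \<le> \<theta>"
          using \<epsilon> by (simp add: mult_le_cancel_right)
        then show ?thesis
          using \<eta> theta_pos by (simp add: pos_divide_le_eq pos_le_divide_eq mult.commute)
      qed
      then have "- (1 / \<eta>) \<le> - (1 / \<theta>) + 2 * \<epsilon> / \<theta>"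
        by (simp add: diff_divide_distrib)
      then have "real n powr (- (1 / \<eta>)) \<le> real n powr (- (1 / \<theta>) + 2 * \<epsilon> / \<theta>)"
        using mn by (intro powr_mono) auto
      also have "\<dots> = real n powr (2 * \<epsilon> / \<theta>) * real n powr (- (1 / \<theta>))"
        by (subst add.commute) (rule powr_add)
      also have "\<dots> \<le> exp (2 / \<theta>) * real n powr (- (1 / \<theta>))"
      proof (rule mult_right_mono)
        have "real n powr (2 * \<epsilon> / \<theta>) = exp (2 * (\<epsilon> * ln (real n)) / \<theta>)"
          using mn by (simp add: powr_def mult.assoc)
        also have "\<dots> \<le> exp (2 / \<theta>)"
          using \<epsilon>(3) theta_pos by (subst exp_le_cancel_iff, intro divide_right_mono) auto
        finally show "real n powr (2 * \<epsilon> / \<theta>) \<le> exp (2 / \<theta>)" .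
      qed simp
      finally show "real n powr (- (1 / \<eta>)) \<le> exp (2 / \<theta>) * real n powr (- (1 / \<theta>))" .
    qed auto
    finally show ?thesis by (simp add: g_def mult.assoc)
  qed
  have "(1 - \<delta>) * v \<le> prob {\<omega> \<in> space M. theta_U x0 xF m \<delta> (\<lambda>t. X t \<omega>) \<in> ?A} * v"
    using prob_theta_U_concentrated[OF m(1) _ \<delta> e(1)] mn
    by (intro mult_right_mono) (auto simp: v_def \<epsilon>_def)
  also have "\<dots> \<le> expectation (\<lambda>\<omega>. X (cdp_ol x0 xF n m \<delta> (\<lambda>t. X t \<omega>)) \<omega>)"
  proof (rule policy_reward_ge[OF mn(1)])
    fix \<eta> assume A: "\<eta> \<in> ?A"
    then have \<eta>: "\<theta> \<le> \<eta>" "0 < \<eta>" using theta_pos by auto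
    have "xF - (xF - x0) * g \<le> xF - (xF - x0) * ((\<eta> + 1) / (\<eta> * real (n - m - 1 + 1))) powr (1 / \<eta>)"
      using gap[OF A] x0_less by (intro diff_left_mono mult_left_mono) auto
    also have "\<dots> \<le> V_rem x0 xF \<eta> (n - m - 1)"
      by (rule V_rem_lower_bound[OF x0_less \<eta>(2)])
    finally have "v \<le> V_rem x0 xF \<eta> (n - m - 1)"
      using V_rem_bounds(1)[OF x0_less \<eta>(2), of "n - m - 1"] x0_nonneg by (simp add: v_def)
    also have "\<dots> \<le> expectation (\<lambda>\<omega>. threshold_reward (V_rem x0 xF \<eta>) n (\<lambda>t. X t \<omega>) (n - m - 1))"
      using mn \<eta> by (intro optimistic_reward_ge) auto
    finally show "v \<le> expectation (\<lambda>\<omega>. threshold_reward (V_rem x0 xF \<eta>) n (\<lambda>t. X t \<omega>) (n - m - 1))" .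
  qed (auto simp: v_def)
  finally have "(1 - \<delta>) * v / xF \<le> CR M n X (\<lambda>\<omega>. cdp_ol x0 xF n m \<delta> (\<lambda>t. X t \<omega>))"
    using mn \<delta> by (intro CR_ge) (auto simp: v_def)
  moreover have "(1 - \<delta>) * (1 - g) \<le> (1 - \<delta>) * (v / xF)"
  proof (rule mult_left_mono)
    \<comment> \<open>Since \<open>x0 \<ge> 0\<close>, the loss \<open>(xF - x0) * g\<close>
      relative to \<open>xF\<close> is at most \<open>g\<close>.\<close>
    have "0 \<le> g" using K by (simp add: g_def)
    then have "(xF - x0) * g \<le> xF * g"
      using x0_nonneg by (intro mult_right_mono) auto
    then have "(1 - g) * xF \<le> v"
      by (simp add: v_def algebra_simps)
    then show "1 - g \<le> v / xF"
      using x0_nonneg x0_less by (simp add: pos_le_divide_eq)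
  qed (use \<delta> in auto)
  ultimately show ?thesis
    by (simp add: g_def K_def)
qed

end

text \<open>With \<delta> bounded away from \<open>1\<close>, \<open>ln (1 / \<delta>)\<close> is
  bounded below, so \<open>ln (2 / \<delta>) = ln 2 + ln (1 / \<delta>)\<close> is at most a
  constant times it. The factor \<open>16\<close> then makes the square of the left-hand side at
  most \<open>1 / 4\<close>.\<close>

lemma eps_times_ln_le:
  assumes c: "0 < c" "c < 1" and \<delta>: "0 < \<delta>" "\<delta> \<le> 1 - c" and n: "1 \<le> ln (real n)"
    and m: "16 * (ln 2 / ln (1 / (1 - c)) + 1) * (ln (1 / \<delta>) * (ln (real n))\<^sup>2) \<le> real m"
  shows "eps m \<delta> * ln (real n) \<le> 1 / 2"
proof -
  define C where "C = ln 2 / ln (1 / (1 - c)) + 1"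
  have l: "0 < ln (1 / (1 - c))" using c by simp
  have C: "0 < C" using l by (simp add: C_def add_pos_pos)
  have l\<delta>: "ln (1 / (1 - c)) \<le> ln (1 / \<delta>)"
    using c \<delta> by (subst ln_le_cancel_iff) (auto intro!: divide_left_mono)
  have "ln 2 \<le> ln 2 / ln (1 / (1 - c)) * ln (1 / \<delta>)"
    using l l\<delta> by (simp add: pos_le_divide_eq)
  then have C\<delta>: "ln (2 / \<delta>) \<le> C * ln (1 / \<delta>)"
    using \<delta>(1) by (simp add: C_def distrib_right ln_div)
  have "0 < ln (1 / \<delta>)" using l l\<delta> by linarith
  then have "0 < 16 * C * (ln (1 / \<delta>) * (ln (real n))\<^sup>2)"
    using C n by (intro mult_pos_pos) auto
  then have m0: "0 < real m" using m unfolding C_def by linarith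
  have "4 * ln (2 / \<delta>) * (ln (real n))\<^sup>2 \<le> 4 * (C * ln (1 / \<delta>)) * (ln (real n))\<^sup>2"
    using C\<delta> by (intro mult_right_mono) auto
  also have "\<dots> \<le> real m / 4"
    using m unfolding C_def[symmetric] by (simp add: mult_ac)
  finally have "4 * ln (2 / \<delta>) / real m * (ln (real n))\<^sup>2 \<le> (1 / 2)\<^sup>2"
    using m0 by (simp add: power2_eq_square pos_divide_le_eq)
  then have "sqrt (4 * ln (2 / \<delta>) / real m * (ln (real n))\<^sup>2) \<le> \<bar>1 / 2\<bar>"
    by (simp only: real_sqrt_le_mono flip: real_sqrt_abs)
  moreover have "sqrt (4 * ln (2 / \<delta>) / real m * (ln (real n))\<^sup>2) = eps m \<delta> * ln (real n)"
    unfolding eps_def by (subst real_sqrt_mult) (use n in simp)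
  ultimately show ?thesis
    by simp
qed

section \<open>Asymptotics: combination of the rate bound and the constant bound\<close>

theorem theorem16:
  fixes x0 xF \<theta> :: real
    and \<delta> :: "nat \<Rightarrow> real"
    and m :: "nat \<Rightarrow> nat"
    and M :: "nat \<Rightarrow> 'a measure"
    and X :: "nat \<Rightarrow> nat \<Rightarrow> 'a \<Rightarrow> real"
  assumes "0 \<le> x0" and "x0 < xF" and "\<theta> > 0"
    and "\<And>n. 0 < \<delta> n \<and> \<delta> n < 1"
    and "(\<lambda>n. real (m n)) \<in> o(\<lambda>n. real n)"
    and "(\<lambda>n. real (m n)) \<in> \<omega>(\<lambda>n. ln (1 / \<delta> n) * (ln (real n))^2)"
    and "\<And>n. iid_sample (M n) n (X n) (F_theta x0 xF \<theta>)"
  shows "\<exists>g \<in> O(\<lambda>n. real n powr (- (1 / \<theta>))).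
    \<forall>\<^sub>F n in sequentially.
      CR (M n) n (X n) (\<lambda>\<omega>. cdp_ol x0 xF n (m n) (\<delta> n) (\<lambda>t. X n t \<omega>))
        \<ge> (1 - \<delta> n) * (1 - g n)"
proof -
  have sample: "power_law_sample (M n) n (X n) x0 xF \<theta>" for n
    using assms(1-3) assms(7)[of n]
    by (auto simp: iid_sample_def power_law_sample_def power_law_sample_axioms_def)
  define C where "C = (2 * (\<theta> + 1) / \<theta>) powr (1 / \<theta>) * exp (2 / \<theta>)"
  define g where "g = (\<lambda>n. C * real n powr (- (1 / \<theta>)))"
  define b where "b = (1 - exp (- (1 / 16))) * (x0 + (xF - x0) / (8 * \<theta> + 1)) / xF"
  \<comment> \<open>The cases split at \<open>\<delta> n = 1 - c\<close>. Beyond it,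
    \<open>1 - \<delta> n < c \<le> b\<close>, and \<open>c \<le> 1 / 2\<close> ensures
    \<open>\<delta> n \<ge> 1 / 2\<close> as \<open>CR_ge_const\<close> demands.\<close>
  define c where "c = min (1 / 2) b"
  have "0 < x0 + (xF - x0) / (8 * \<theta> + 1)"
    using assms by (intro add_nonneg_pos) auto
  then have "0 < b"
    using assms by (simp add: b_def)
  then have c: "0 < c" "c < 1" "c \<le> 1 / 2" "c \<le> b"
    by (auto simp: c_def)
  define c' where "c' = 16 * (ln 2 / ln (1 / (1 - c)) + 1)"
  have c': "0 < c'" using c by (simp add: c'_def add_pos_pos)
  have "\<forall>\<^sub>F n in sequentially. c' * norm (ln (1 / \<delta> n) * (ln (real n))^2) \<le> norm (real (m n))"
    using landau_omega.smallD[OF assms(6) c'] .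
  moreover have "\<forall>\<^sub>F n in sequentially. norm (real (m n)) \<le> 1 / 2 * norm (real n)"
    using landau_o.smallD[OF assms(5), of "1 / 2"] by simp
  moreover have "\<forall>\<^sub>F n in sequentially. 1 \<le> ln (real n)"
    using filterlim_compose[OF ln_at_top filterlim_real_sequentially]
    by (auto simp: filterlim_at_top)
  ultimately have "\<forall>\<^sub>F n in sequentially.
      CR (M n) n (X n) (\<lambda>\<omega>. cdp_ol x0 xF n (m n) (\<delta> n) (\<lambda>t. X n t \<omega>)) \<ge> (1 - \<delta> n) * (1 - g n)"
  proof eventually_elim
    case (elim n)
    interpret power_law_sample "M n" n "X n" x0 xF \<theta> by (rule sample)
    have \<delta>: "0 < \<delta> n" "\<delta> n < 1" using assms(4)[of n] by auto
    have l: "0 < ln (1 / \<delta> n)" using \<delta> by simp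
    have big: "c' * (ln (1 / \<delta> n) * (ln (real n))\<^sup>2) \<le> real (m n)"
      using elim(1) l by (simp add: abs_mult)
    \<comment> \<open>The growth condition also makes the exploration phase nonempty.\<close>
    have "0 < c' * (ln (1 / \<delta> n) * (ln (real n))\<^sup>2)"
      using c' l elim(3) by (intro mult_pos_pos) auto
    with big have m0: "0 < m n" by linarith
    have mn: "2 * m n \<le> n" using elim(2) by simp
    show ?case
    proof (cases "\<delta> n \<le> 1 - c")
      case True
      have e: "eps (m n) (\<delta> n) * ln (real n) \<le> 1 / 2"
        using c \<delta> True elim(3) big unfolding c'_def by (intro eps_times_ln_le[of c]) auto
      \<comment> \<open>As \<open>ln n \<ge> 1\<close>, the bound on the product also bounds
        \<open>eps\<close> itself.\<close>
      have "eps (m n) (\<delta> n) * 1 \<le> eps (m n) (\<delta> n) * ln (real n)"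
        using elim(3) \<delta> by (intro mult_left_mono) (auto simp: eps_def)
      with e have "eps (m n) (\<delta> n) \<le> 1 / 2" "eps (m n) (\<delta> n) * ln (real n) \<le> 1" by auto
      from CR_ge_rate[OF m0 mn \<delta> this] show ?thesis
        by (simp add: g_def C_def)
    next
      case False
      \<comment> \<open>Since \<open>g\<close> is nonnegative, the target is at most
        \<open>1 - \<delta> n\<close>, which lies below the constant bound \<open>b\<close>.\<close>
      have "0 \<le> g n" by (simp add: g_def C_def)
      then have "(1 - \<delta> n) * (1 - g n) \<le> (1 - \<delta> n) * 1"
        using \<delta> by (intro mult_left_mono) auto
      also have "\<dots> \<le> b" using False c by simp
      also have "\<dots> \<le> CR (M n) n (X n) (\<lambda>\<omega>. cdp_ol x0 xF n (m n) (\<delta> n) (\<lambda>t. X n t \<omega>))"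
        unfolding b_def using False c \<delta> m0 mn by (intro CR_ge_const) auto
      finally show ?thesis .
    qed
  qed
  then show ?thesis
  proof (rule bexI[of _ g])
    show "g \<in> O(\<lambda>n. real n powr (- (1 / \<theta>)))"
      unfolding g_def by (rule bigoI[where c = C]) (simp add: C_def)
  qed
qed

end
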